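(* Let $p\ge3$, $n\ge1$, and let $X\sim N_p(\theta,\sigma^2I_p)$ and $Z\sim N_n(0,\sigma^2I_n)$ be independent, with $\theta\in\mathbb{R}^p$, $\sigma>0$ unknown; let $S=Z'Z$, $W=\|X\|^2/S$. For real $a,b,e$ consider the generalized Bayes estimator $\delta=(1-\phi(W)/W)X$ with $$\phi(w)=w\,\frac{\int_0^1\lambda^{p/2+a+1}(1-\lambda)^b(1+w\lambda)^{-p/2-n/2-e-2}\,d\lambda}{\int_0^1\lambda^{p/2+a}(1-\lambda)^b(1+w\lambda)^{-p/2-n/2-e-2}\,d\lambda}.$$ Suppose $e>-p/2-n/2-1$, and let $c(p,n)=2(p-2)/(n+2)$ and $\alpha=(p/2+a+1)/(n/2+e-a)$. (i) If $-p/2-1<a\le\frac{c(p,n)(n/2+e)-p/2-1}{1+c(p,n)}$ and $b\ge\min(n/2+e-a-1,0)$, then $\delta$ is minimax. (ii) If $-p/2-1<a<\frac{c(p,n)(n/2+e)-p/2-1}{1+c(p,n)}$ and $$-1<-(n+2)\frac{c(p,n)-\alpha}{4(p+a+1)(\alpha+1)}\le b<\min(0,\,n/2+e-a-1),$$ then $\delta$ is minimax.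
   Context: $\delta$ is the generalized Bayes estimator $E(\eta\theta\mid X,S)/E(\eta\mid X,S)$, $\eta=1/\sigma^2$, under the hierarchical prior $\theta\mid\eta,\lambda\sim N_p(0,\eta^{-1}(1-\lambda)\lambda^{-1}I_p)$, $\eta\sim\eta^e$, $\lambda\sim\lambda^a(1-\lambda)^b$ on $(0,1)$. Minimaxity is for estimating $\theta$ under the loss $(\delta-\theta)'(\delta-\theta)/\sigma^2$; $X$ is minimax with constant risk, so $\delta$ is minimax iff its risk is at most that of $X$ for all $\theta,\sigma^2$. *)

theory Defs
  imports "HOL-Probability.Probability"
begin

definition model :: "real^'p \<Rightarrow> real \<Rightarrow> ((real^'p) \<times> (real^'n)) measure" where
  "model \<theta> \<sigma> = density lborel
     (\<lambda>(x, z). ennreal ((\<Prod>i\<in>UNIV. normal_density (\<theta> $ i) \<sigma> (x $ i)) *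
                         (\<Prod>j\<in>UNIV. normal_density 0 \<sigma> (z $ j))))"

definition risk :: "((real^'p) \<times> (real^'n) \<Rightarrow> real^'p) \<Rightarrow> real^'p \<Rightarrow> real \<Rightarrow> ennreal" where
  "risk d \<theta> \<sigma> = (\<integral>\<^sup>+ xz. ennreal ((norm (d xz - \<theta>))\<^sup>2 / \<sigma>\<^sup>2) \<partial>(model \<theta> \<sigma>))"

definition max_risk :: "((real^'p) \<times> (real^'n) \<Rightarrow> real^'p) \<Rightarrow> ennreal" where
  "max_risk d = (SUP \<theta>\<in>UNIV. SUP \<sigma>\<in>{0<..}. risk d \<theta> \<sigma>)"

definition minimax :: "((real^'p) \<times> (real^'n) \<Rightarrow> real^'p) \<Rightarrow> bool" where
  "minimax \<delta> \<longleftrightarrow> \<delta> \<in> borel_measurable borel \<and>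
     max_risk \<delta> \<le> (INF d\<in>(borel_measurable borel :: ((real^'p) \<times> (real^'n) \<Rightarrow> real^'p) set). max_risk d)"

definition phi :: "real \<Rightarrow> real \<Rightarrow> real \<Rightarrow> real \<Rightarrow> real \<Rightarrow> real \<Rightarrow> real" where
  "phi p n a b e w = w *
     (LBINT l=0..1. l powr (p/2 + a + 1) * (1 - l) powr b * (1 + w * l) powr (- p/2 - n/2 - e - 2)) /
     (LBINT l=0..1. l powr (p/2 + a) * (1 - l) powr b * (1 + w * l) powr (- p/2 - n/2 - e - 2))"

definition delta :: "real \<Rightarrow> real \<Rightarrow> real \<Rightarrow> (real^'p) \<times> (real^'n) \<Rightarrow> real^'p" where
  "delta a b e xz =
     (let x = fst xz; z = snd xz; p = real CARD('p); n = real CARD('n);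
          S = (norm z)\<^sup>2; W = (norm x)\<^sup>2 / S
      in (1 - phi p n a b e W / W) *\<^sub>R x)"

end

theory Submission
  imports Defs
begin

text \<open>
  Write \<open>A = p/2 + a + 1\<close> and \<open>m = n/2 + e - a\<close>. Stein's identity in \<open>X\<close> and in \<open>Z\<close> bounds the risk of
  \<open>\<delta>\<close> by \<open>p\<close> as soon as \<open>(n + 2) (c - \<phi>) \<phi> + 4 (1 + \<phi>) w \<phi>' \<ge> 0\<close> for all \<open>w > 0\<close>, and \<open>p\<close> is the minimax
  value because it is the limit of the Bayes risks under normal priors with growing variance.

  Integration by parts in the defining integrals gives the Riccati equation
  \<open>w (1 + w) \<phi>' = (A - m \<phi>) (w - \<phi>) - b \<phi> (1 + \<phi>)\<close>, from which the inequality follows by barrier arguments.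
  In (i) they show \<open>\<phi> \<le> A/m \<le> c\<close> and \<open>\<phi>' \<ge> 0\<close>. In (ii) \<open>\<phi>\<close> may exceed its limit \<open>\<alpha> = A/m\<close>, but
  \<open>\<phi>/(1 + \<phi>) \<le> (\<alpha>/(1 + \<alpha>))/(1 + b)\<close> and \<open>w \<phi>'/\<phi> \<ge> b (A + 1)/(1 + b)\<close>; these two bounds combine linearly
  to the required inequality exactly under the stated lower bound on \<open>b\<close>.
\<close>

section \<open>Barrier arguments\<close>

text \<open>Put x = \<phi>/(1 + \<phi>). Dividing the risk inequality by \<phi> (1 + \<phi>) turns
  it into (n + 2) (c - (c + 1) x) + 4 w \<phi>'/\<phi> >= 0, which is linear in x and in the
  logarithmic derivative; hence the two quantities bounded in (ii). Inserting both bounds and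
  multiplying by 1 + b gives (n + 2) (c - \<alpha>)/(1 + \<alpha>) + b ((n + 2) c + 4 (A + 1)) >= 0.
  Since (n + 2) c + 4 (A + 1) = 4 (p + a + 1), this is the stated lower bound on b.

  The Riccati equation is singular at w = 0, so no barrier can start there. Each one starts at some
  r > 0, where the integrals or an earlier barrier already supply a bound.\<close>

lemma strict_barrier:
  fixes g g' :: "real \<Rightarrow> real"
  assumes "r \<le> s"
    and der: "\<And>u. r \<le> u \<Longrightarrow> u \<le> s \<Longrightarrow> (g has_real_derivative g' u) (at u)"
    and start: "g r \<ge> 0"
    and up: "\<And>u. r \<le> u \<Longrightarrow> u \<le> s \<Longrightarrow> g u = 0 \<Longrightarrow> g' u > 0"
  shows "g s \<ge> 0"
proof (rule ccontr)
  assume neg: "\<not> g s \<ge> 0"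
  have cont: "continuous_on {r..s} g"
    using der by (meson DERIV_isCont atLeastAtMost_iff continuous_at_imp_continuous_on)
  define T where "T = {r..s} \<inter> g -` {0..}"
  have cT: "closed T"
    unfolding T_def by (rule continuous_closed_preimage[OF cont]) auto
  have "r \<in> T" using assms(1) start by (auto simp: T_def)
  have bT: "bdd_above T" by (auto simp: T_def)
  \<comment> \<open>\<open>v\<close> is the last point with \<open>g\<close> nonnegative. Continuity
    forces \<open>g v = 0\<close>, so \<open>up\<close> makes \<open>g\<close> positive just to the
    right of \<open>v\<close>, against the choice of \<open>v\<close>.\<close>
  define v where "v = Sup T"
  have vT: "v \<in> T" using closed_contains_Sup[OF _ bT cT] \<open>r \<in> T\<close> by (auto simp: v_def)
  then have v: "r \<le> v" "v \<le> s" "g v \<ge> 0" by (auto simp: T_def)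
  with neg have "v < s" by (cases "v = s") auto
  have after: "g u < 0" if "v < u" "u \<le> s" for u
  proof (rule ccontr)
    assume "\<not> g u < 0"
    with that v have "u \<in> T" by (auto simp: T_def)
    then have "u \<le> v" unfolding v_def using bT by (rule cSup_upper)
    with that show False by simp
  qed
  have "g v = 0"
  proof (rule ccontr)
    assume "g v \<noteq> 0"
    with v have "g v > 0" by simp
    moreover have "g s < 0" using neg by simp
    ultimately obtain u where u: "v \<le> u" "u \<le> s" "g u = 0"
      using IVT2'[of g s 0 v] cont \<open>v < s\<close> v
      by (metis atLeastatMost_subset_iff continuous_on_subset less_eq_real_def order_refl)
    with \<open>g v > 0\<close> have "v < u" by (cases "u = v") auto
    with after[of u] u show False by simp
  qed
  then have "g' v > 0" using up v by auto
  from DERIV_pos_inc_right[OF der this] v obtain d where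
    d: "d > 0" "\<And>h. h > 0 \<Longrightarrow> h < d \<Longrightarrow> g v < g (v + h)" by auto
  define h where "h = min (d/2) (s - v)"
  have "h > 0" "h < d" "v + h \<le> s" using d(1) \<open>v < s\<close> by (auto simp: h_def min_def)
  with d(2)[of h] after[of "v + h"] \<open>g v = 0\<close> show False by auto
qed

lemma weak_barrier:
  fixes g g' :: "real \<Rightarrow> real"
  assumes "r \<le> s"
    and der: "\<And>u. r \<le> u \<Longrightarrow> u \<le> s \<Longrightarrow> (g has_real_derivative g' u) (at u)"
    and start: "g r \<ge> 0"
    and up: "\<And>u. r \<le> u \<Longrightarrow> u \<le> s \<Longrightarrow> g u < 0 \<Longrightarrow> g' u \<ge> 0"
  shows "g s \<ge> 0"
proof (rule field_le_epsilon)
  fix \<epsilon> :: real assume "\<epsilon> > 0"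
  \<comment> \<open>The tilt \<open>\<kappa> * (u - r + 1)\<close> makes the derivative condition
    strict. The summand 1 keeps the tilt positive even at \<open>u = r\<close>, so \<open>g\<close>
    is negative at each zero of the tilted function and \<open>up\<close> applies; at
    \<open>s\<close> the tilt is exactly \<open>\<epsilon>\<close>.\<close>
  define \<kappa> where "\<kappa> = \<epsilon> / (s - r + 1)"
  have k: "\<kappa> > 0" using \<open>\<epsilon> > 0\<close> assms(1) by (simp add: \<kappa>_def)
  have "g s + \<kappa> * (s - r + 1) \<ge> 0"
  proof (rule strict_barrier[where g = "\<lambda>u. g u + \<kappa> * (u - r + 1)" and g' = "\<lambda>u. g' u + \<kappa>", OF assms(1)])
    fix u assume u: "r \<le> u" "u \<le> s"
    show "((\<lambda>u. g u + \<kappa> * (u - r + 1)) has_real_derivative g' u + \<kappa>) (at u)"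
      by (auto intro!: derivative_eq_intros der u)
    assume "g u + \<kappa> * (u - r + 1) = 0"
    moreover have "\<kappa> * (u - r + 1) > 0" using k u by simp
    ultimately have "g u < 0" by linarith
    from up[OF u this] k show "g' u + \<kappa> > 0" by simp
  qed (use start k in auto)
  then show "0 \<le> g s + \<epsilon>" using assms(1) by (simp add: \<kappa>_def)
qed

text \<open>
  The curve \<open>m - t * (T + K / (u - al))\<close> is a strict subsolution of the equation for \<open>\<zeta>\<close>. It comes from
  solving the desired bound on the logarithmic derivative of \<open>\<phi>\<close> for \<open>\<zeta>\<close>, with \<open>\<phi>\<close> replaced by its
  limit \<open>al = A / m\<close> at infinity; here \<open>t = - b\<close> and \<open>y\<close> is the factor of \<open>t\<close>.
\<close>

lemma barrier_polynomial:
  fixes A m T t z y u :: real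
  defines "al \<equiv> A / m" and "M \<equiv> A + m"
  defines "K \<equiv> (T + 1) * (1 + al)"
  assumes A: "A > 0" and m: "m > 0" and t: "0 < t" "t < 1"
    and T: "(1 - t) * T = A + 1"
    and u: "u > al" and y: "y = T + K / (u - al)" "y \<le> M" and z: "z = m - t * y"
  shows "y * (z * u - A) - (z + A) > K * u * (1 + u) / (u - al)\<^sup>2"
proof -
  define d where "d = u - al"
  have d: "d > 0" using u by (simp add: d_def)
  have al: "al > 0" "A = al * m" using A m by (auto simp: al_def)
  have ud: "u = al + d" by (simp add: d_def)
  have u0: "u > 0" using ud al d by simp
  have T0: "T > 0" using T A t by (metis add_pos_pos diff_gt_0_iff_gt zero_less_mult_pos zero_less_one)
  have K0: "K > 0" using T0 al by (simp add: K_def)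
  define h where "h = y - T"
  have hd: "h * d = K" using d by (simp add: h_def y(1) d_def)
  have h0: "h > 0" using hd K0 d by (metis zero_less_mult_pos2)
  have yh: "y = T + h" by (simp add: h_def)
  have M: "M = m * (1 + al)" by (simp add: M_def al(2) algebra_simps)
  \<comment> \<open>The value of \<open>K\<close> gives y d = T d + (T + 1) (1 + al), so the term m
    (1 + al) cancels and a factor 1 + u appears. By \<open>S4\<close> the remaining term carries
    this factor as well.\<close>
  have S1: "y * (z * u - A) - (z + A) = m * T * (1 + u) - t * y * (y * u - 1)"
  proof -
    have "y * d = T * d + K" using hd by (simp add: yh algebra_simps)
    then have yd: "y * d = T * d + (T + 1) * (1 + al)" by (simp add: K_def)
    have "y * (z * u - A) - (z + A) = m * (y * d) - m * (1 + al) - t * y * (y * u - 1)"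
      unfolding z al(2) ud by (simp add: algebra_simps)
    also have "\<dots> = m * T * (1 + u) - t * y * (y * u - 1)"
      unfolding yd ud by (simp add: algebra_simps)
    finally show ?thesis .
  qed
  have S2: "(1 + u) * h = (1 + al) * (y + 1)"
    using hd by (simp add: yh ud K_def algebra_simps)
  have S4: "(y * u - 1) * (1 + al) = (1 + u) * (al * y + T)"
    using S2 by (simp add: yh algebra_simps)
  have S3: "K * u / d\<^sup>2 = al * h\<^sup>2 / K + h"
    using d K0 unfolding hd[symmetric] ud by (simp add: field_simps power2_eq_square)
  \<comment> \<open>This is the claim divided by 1 + u. The terms are bounded using
    \<open>y \<le> M\<close>, and by (1 - t) T = A + 1 the bounds add up to m T - T; the slack T > 0
    makes the subsolution strict.\<close>
  have S5: "al * h\<^sup>2 / K + h + t * y * (al * y + T) / (1 + al) < m * T"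
  proof -
    have MT: "h \<le> M - T" using y(2) by (simp add: h_def)
    have "al * h\<^sup>2 / K \<le> al * (M - T)\<^sup>2 / K"
      using MT h0 al K0 by (intro divide_right_mono mult_left_mono power_mono) auto
    also have "\<dots> \<le> (1 - t) * A * (M - T)"
    proof -
      have M0: "M > 0" using A m by (simp add: M_def)
      have "(1 - t) * (T + 1) \<ge> 1" using T A t by (simp add: algebra_simps)
      moreover have "M - T \<le> M" using T0 by simp
      ultimately have "1 * (M - T) \<le> (1 - t) * (T + 1) * M"
        using MT h0 by (intro mult_mono) auto
      then have "al * (M - T) * (M - T) \<le> al * ((1 - t) * (T + 1) * M) * (M - T)"
        using al MT h0 by (intro mult_right_mono mult_left_mono) auto
      also have "\<dots> = (1 - t) * A * (M - T) * K"
        unfolding K_def al(2) M by (simp add: algebra_simps)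
      finally show ?thesis using K0 by (simp add: divide_le_eq power2_eq_square mult_ac)
    qed
    finally have 1: "al * h\<^sup>2 / K \<le> (1 - t) * A * (M - T)" .
    have y0: "y > 0" using yh T0 h0 by simp
    have "t * y * (al * y + T) / (1 + al) \<le> t * M * (al * M + T) / (1 + al)"
      using y(2) y0 al t T0 by (intro divide_right_mono mult_mono add_mono) auto
    also have "\<dots> = t * (A * M + m * T)"
      using al(1) unfolding M al(2) by (simp add: field_simps)
    finally have 2: "t * y * (al * y + T) / (1 + al) \<le> t * (A * M + m * T)" .
    have "(1 - t) * A * (M - T) + (M - T) + t * (A * M + m * T) = m * T - T"
    proof -
      have "(1 - t) * A * (M - T) + (M - T) + t * (A * M + m * T) =
         A * M - A * ((1 - t) * T) + M - T + m * T - m * ((1 - t) * T)"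
        by (simp add: algebra_simps)
      also have "\<dots> = m * T - T" unfolding T M_def by (simp add: algebra_simps)
      finally show ?thesis .
    qed
    with 1 2 MT T0 show ?thesis by linarith
  qed
  have "K * u * (1 + u) / d\<^sup>2 = (1 + u) * (al * h\<^sup>2 / K + h)"
    unfolding S3[symmetric] by simp
  moreover have "t * y * (y * u - 1) = (1 + u) * (t * y * (al * y + T) / (1 + al))"
  proof -
    have "y * u - 1 = (1 + u) * (al * y + T) / (1 + al)" using S4 al by (simp add: field_simps)
    then show ?thesis by simp
  qed
  moreover have "(1 + u) * (al * h\<^sup>2 / K + h + t * y * (al * y + T) / (1 + al)) < (1 + u) * (m * T)"
    using S5 u0 by simp
  ultimately show ?thesis unfolding S1 d_def[symmetric] by (simp add: algebra_simps)
qed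

section \<open>The Riccati equation\<close>

lemma measurable_if_positive:
  fixes f :: "real \<Rightarrow> real"
  assumes "\<And>w. w > 0 \<Longrightarrow> isCont f w"
  shows "(\<lambda>w. if w > 0 then f w else 0) \<in> borel_measurable borel"
proof -
  have "continuous_on {0<..} f" using assms by (auto intro!: continuous_at_imp_continuous_on)
  then have "(\<lambda>w. indicator {0<..} w *\<^sub>R f w) \<in> borel_measurable borel"
    by (intro borel_measurable_continuous_on_indicator) auto
  also have "(\<lambda>w. indicator {0<..} w *\<^sub>R f w) = (\<lambda>w. if w > 0 then f w else 0)"
    by (auto simp: indicator_def)
  finally show ?thesis .
qed

lemma measurable_fst_snd [measurable]:
  "(fst :: 'a::euclidean_space \<times> 'b::euclidean_space \<Rightarrow> _) \<in> borel_measurable borel"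
  "(snd :: 'a::euclidean_space \<times> 'b::euclidean_space \<Rightarrow> _) \<in> borel_measurable borel"
  by (auto intro!: borel_measurable_continuous_onI continuous_intros)

text \<open>With \<open>A = p/2 + a + 1\<close> and \<open>m = n/2 + e - a\<close>, the Beta weight
  of the denominator of \<open>phi\<close> has parameters \<open>A\<close> and \<open>b + 1\<close>,
  and the exponent p/2 + n/2 + e + 2 equals \<open>A + m + 1\<close>, called \<open>k\<close> below.
  The conditions on \<open>A\<close> and \<open>b\<close> are integrability at 0 and 1;
  \<open>m > 0\<close> makes the limit A / m meaningful.\<close>

locale beta_ratio =
  fixes A b m :: real
  assumes A: "A > 0" and b: "b > -1" and m: "m > 0"
begin

text \<open>The weight, possibly unbounded at the end points, is absorbed into a finite measure, so
  that integrability of everything else follows from boundedness on (0,1).\<close>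

definition mix :: "real measure" where
  "mix = density lborel (\<lambda>l. ennreal (indicator {0<..<1} l * (l powr (A - 1) * (1 - l) powr b)))"

text \<open>\<open>phi\<close> involves only \<open>i\<close> = 0, 1 and \<open>r = k\<close>.
  Differentiation in \<open>w\<close> raises both indices, and the recursions below bring them
  back.\<close>

definition mom :: "nat \<Rightarrow> real \<Rightarrow> real \<Rightarrow> real" where
  "mom i r w = (\<integral>l. l ^ i * (1 + w * l) powr (- r) \<partial>mix)"

lemma sets_mix [measurable_cong, simp]: "sets mix = sets borel" and space_mix [simp]: "space mix = UNIV"
  by (simp_all add: mix_def)

lemma weight_integrable:
  "integrable lborel (\<lambda>l::real. indicator {0<..<1} l * (l powr (A - 1) * (1 - l) powr b))"
proof -
  have "set_integrable lborel {0..1} (\<lambda>l::real. l powr (A - 1) * (1 - l) powr (b + 1 - 1))"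
    by (rule integrable_Beta) (use A b in auto)
  then have "set_integrable lborel {0<..<1} (\<lambda>l::real. l powr (A - 1) * (1 - l) powr b)"
    by (auto intro: set_integrable_subset)
  then show ?thesis by (simp add: set_integrable_def)
qed

lemma finite_mix: "finite_measure mix"
proof
  have "emeasure mix (space mix) = (\<integral>\<^sup>+l. ennreal (indicator {0<..<1} l * (l powr (A - 1) * (1 - l) powr b)) \<partial>lborel)"
    by (simp add: mix_def emeasure_density)
  also have "\<dots> < \<infinity>"
    using weight_integrable by (subst nn_integral_eq_integral) (auto simp: indicator_def)
  finally show "emeasure mix (space mix) \<noteq> \<infinity>" by simp
qed

sublocale mix: finite_measure mix by (rule finite_mix)

lemma AE_mix: "AE l in mix. 0 < l \<and> l < 1"
  unfolding mix_def by (subst AE_density) (auto simp: indicator_def)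

lemma integral_mix:
  assumes [measurable]: "f \<in> borel_measurable borel"
  shows "(\<integral>l. f l \<partial>mix) = (LBINT l=0..1. l powr (A - 1) * (1 - l) powr b * f l)"
proof -
  have "(\<integral>l. f l \<partial>mix) = (\<integral>l. indicator {0<..<1} l * (l powr (A - 1) * (1 - l) powr b) * f l \<partial>lborel)"
    unfolding mix_def by (subst integral_density) (auto simp: indicator_def)
  also have "\<dots> = (LBINT l=0..1. l powr (A - 1) * (1 - l) powr b * f l)"
    by (simp add: interval_lebesgue_integral_def set_lebesgue_integral_def einterval_eq mult.assoc
        flip: zero_ereal_def one_ereal_def)
      (simp add: zero_ereal_def one_ereal_def einterval_eq)
  finally show ?thesis .
qed

lemma integrable_mix:
  fixes B :: real
  assumes [measurable]: "f \<in> borel_measurable borel" and "\<And>l. 0 < l \<Longrightarrow> l < 1 \<Longrightarrow> \<bar>f l\<bar> \<le> B"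
  shows "integrable mix f"
  using AE_mix assms by (intro mix.integrable_const_bound[where B = B]) auto

lemma mom_integrable:
  assumes "w \<ge> 0" "r \<ge> 0"
  shows "integrable mix (\<lambda>l. l ^ i * (1 + w * l) powr (- r))"
proof (rule integrable_mix[where B = 1])
  fix l :: real assume l: "0 < l" "l < 1"
  have "(1 + w * l) powr (- r) \<le> 1"
    using assms l by (simp add: powr_minus inverse_le_1_iff ge_one_powr_ge_zero)
  moreover have "l ^ i \<le> 1" using l by (simp add: power_le_one)
  ultimately show "\<bar>l ^ i * (1 + w * l) powr (- r)\<bar> \<le> 1"
    using l by (simp add: abs_mult mult_le_one)
qed measurable

text \<open>Differentiation under the integral: the kernel has \<open>w\<close>-derivative at most
  \<open>r\<close> in absolute value, uniformly in \<open>l\<close> and \<open>w\<close>, so the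
  constant \<open>r\<close> dominates all difference quotients.\<close>

lemma mom_deriv:
  assumes w: "w > 0" and r: "r \<ge> 0"
  shows "(mom i r has_real_derivative - r * mom (Suc i) (r + 1) w) (at w)"
proof -
  let ?p = "\<lambda>l y. (1 + y * l) powr (- r)"
  have der: "(?p l has_real_derivative - r * l * (1 + y * l) powr (- (r + 1))) (at y)"
    if "0 < l" "0 < y" for l y :: real
  proof -
    have "1 + y * l > 0" using that by (simp add: add_pos_pos)
    moreover have "((\<lambda>y. 1 + y * l) has_real_derivative l) (at y)"
      by (auto intro!: derivative_eq_intros)
    ultimately show ?thesis
      using DERIV_fun_powr[of "\<lambda>y. 1 + y * l" l y "- r"] by (simp add: mult_ac)
  qed
  have bound: "\<bar>?p l y - ?p l w\<bar> \<le> r * \<bar>y - w\<bar>" if l: "0 < l" "l < 1" and y: "0 < y" for l y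
  proof -
    have "norm (?p l y - ?p l w) \<le> r * norm (y - w)"
    proof (rule field_differentiable_bound[where S = "{0<..}" and f = "?p l"
          and f' = "\<lambda>u. - r * l * (1 + u * l) powr (- (r + 1))"])
      fix u :: real assume u: "u \<in> {0<..}"
      show "(?p l has_real_derivative - r * l * (1 + u * l) powr (- (r + 1))) (at u within {0<..})"
        by (rule has_field_derivative_at_within, rule der) (use l u in auto)
      have "(1 + u * l) powr (- (r + 1)) \<le> 1"
        using r l u by (subst powr_minus) (simp add: inverse_le_1_iff ge_one_powr_ge_zero)
      then have "l * (1 + u * l) powr (- (r + 1)) \<le> 1"
        using l by (intro mult_le_one) auto
      then show "norm (- r * l * (1 + u * l) powr (- (r + 1))) \<le> r"
        using r l by (simp add: abs_mult mult.assoc mult_left_le)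
    qed (use y w in auto)
    then show ?thesis by simp
  qed
  have "(\<lambda>n. (mom i r (X n) - mom i r w) / (X n - w)) \<longlonglongrightarrow> - r * mom (Suc i) (r + 1) w"
    if X: "\<And>n. X n \<in> {0<..} - {w}" "X \<longlonglongrightarrow> w" for X
  proof -
    let ?q = "\<lambda>n l. l ^ i * ((?p l (X n) - ?p l w) / (X n - w))"
    have "(\<lambda>n. \<integral>l. ?q n l \<partial>mix) \<longlonglongrightarrow> (\<integral>l. l ^ i * (- r * l * (1 + w * l) powr (- (r + 1))) \<partial>mix)"
    proof (rule integral_dominated_convergence[where w = "\<lambda>_. r"])
      show "AE l in mix. (\<lambda>n. ?q n l) \<longlonglongrightarrow> l ^ i * (- r * l * (1 + w * l) powr (- (r + 1)))"
        using AE_mix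
      proof eventually_elim
        case (elim l)
        have "((\<lambda>y. (?p l y - ?p l w) / (y - w)) \<longlongrightarrow> - r * l * (1 + w * l) powr (- (r + 1))) (at w)"
          using der[of l w] elim w by (simp add: has_field_derivative_iff)
        moreover have "filterlim X (at w) sequentially"
          using X by (auto simp: filterlim_at)
        ultimately show ?case
          by (intro tendsto_mult tendsto_const) (rule filterlim_compose)
      qed
      show "AE l in mix. norm (?q n l) \<le> r" for n
        using AE_mix
      proof eventually_elim
        case (elim l)
        have "X n > 0" "X n \<noteq> w" using X(1)[of n] by auto
        then have "\<bar>?p l (X n) - ?p l w\<bar> / \<bar>X n - w\<bar> \<le> r"
          using bound[of l "X n"] elim by (simp add: divide_le_eq)
        moreover have "l ^ i \<le> 1" using elim by (simp add: power_le_one)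
        ultimately have "l ^ i * (\<bar>?p l (X n) - ?p l w\<bar> / \<bar>X n - w\<bar>) \<le> 1 * r"
          using elim r by (intro mult_mono) auto
        then show ?case using elim by (simp add: abs_mult)
      qed
    qed (simp_all, measurable)
    also have "(\<lambda>n. \<integral>l. ?q n l \<partial>mix) = (\<lambda>n. (mom i r (X n) - mom i r w) / (X n - w))"
    proof
      fix n
      have pos: "X n > 0" using X(1)[of n] by auto
      have "(mom i r (X n) - mom i r w) / (X n - w) =
          (\<integral>l. l ^ i * ?p l (X n) - l ^ i * ?p l w \<partial>mix) / (X n - w)"
        unfolding mom_def using pos w r by (subst Bochner_Integration.integral_diff) (auto intro: mom_integrable)
      also have "\<dots> = (\<integral>l. ?q n l \<partial>mix)"
        by (subst integral_divide_zero[symmetric]) (simp add: algebra_simps diff_divide_distrib)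
      finally show "(\<integral>l. ?q n l \<partial>mix) = (mom i r (X n) - mom i r w) / (X n - w)" ..
    qed
    also have "(\<integral>l. l ^ i * (- r * l * (1 + w * l) powr (- (r + 1))) \<partial>mix) = - r * mom (Suc i) (r + 1) w"
      unfolding mom_def by (subst integral_mult_right_zero[symmetric]) (simp add: algebra_simps)
    finally show ?thesis .
  qed
  then have "((\<lambda>y. (mom i r y - mom i r w) / (y - w)) \<longlongrightarrow> - r * mom (Suc i) (r + 1) w) (at w within {0<..})"
    by (subst tendsto_at_iff_sequentially) (auto simp: o_def)
  then have "(mom i r has_real_derivative - r * mom (Suc i) (r + 1) w) (at w within {0<..})"
    by (simp add: has_field_derivative_iff)
  moreover have "at w within {0<..} = at w" using w by (intro at_within_open) auto
  ultimately show ?thesis by (simp only:)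
qed

text \<open>The integrand, together with the weight, is the derivative of l^A (1 - l)^(b + 1) (1 + w
  l)^(-r). This function vanishes at both ends because \<open>A > 0\<close> and
  \<open>b + 1 > 0\<close>.\<close>

lemma by_parts:
  assumes w: "w > 0"
  shows "(\<integral>l. (A * (1 - l) * (1 + w * l) - r * w * l * (1 - l) - (b + 1) * l * (1 + w * l)) *
             (1 + w * l) powr (- (r + 1)) \<partial>mix) = 0"
proof -
  let ?P = "\<lambda>l. A * (1 - l) * (1 + w * l) - r * w * l * (1 - l) - (b + 1) * l * (1 + w * l)"
  let ?h = "\<lambda>l. ?P l * (1 + w * l) powr (- (r + 1))"
  let ?F = "\<lambda>l. l powr A * (1 - l) powr (b + 1) * (1 + w * l) powr (- r)"
  let ?f = "\<lambda>l. l powr (A - 1) * (1 - l) powr b * ?h l"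
  have pos: "1 + w * l > 0" if "0 \<le> l" for l using w that by (simp add: add_pos_nonneg)
  have "continuous_on {0..1} ?h"
    using pos by (intro continuous_intros) (auto simp: less_imp_neq[symmetric])
  then have "compact (?h ` {0..1})" by (rule compact_continuous_image) simp
  then obtain B where B: "\<And>l. l \<in> {0..1} \<Longrightarrow> \<bar>?h l\<bar> \<le> B"
    by (metis (no_types, lifting) bounded_iff compact_imp_bounded image_eqI real_norm_def)
  have int: "integrable mix ?h" by (rule integrable_mix[where B = B]) (use B in auto)
  have "(LBINT l=ereal 0..ereal 1. ?f l) = 0 - 0"
  proof (rule interval_integral_FTC_integrable[where F = ?F])
    fix l assume "ereal 0 < ereal l" "ereal l < ereal 1"
    then have l: "0 < l" "l < 1" by auto
    have e: "l powr A = l powr (A - 1) * l" "(1 - l) powr (b + 1) = (1 - l) powr b * (1 - l)"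
      "(1 + w * l) powr (- r) = (1 + w * l) powr (- (r + 1)) * (1 + w * l)"
      using l pos[of l] powr_add[of l "A - 1" 1] powr_add[of "1 - l" b 1] powr_add[of "1 + w * l" "- (r + 1)" 1]
      by (simp_all)
    have "(?F has_real_derivative ?f l) (at l)"
      using l pos[of l]
      by (auto intro!: derivative_eq_intros simp: e) (simp add: algebra_simps)
    then show "(?F has_vector_derivative ?f l) (at l)"
      by (simp add: has_real_derivative_iff_has_vector_derivative)
    show "isCont ?f l" using l pos[of l] by (intro continuous_intros) auto
  next
    have "integrable lborel (\<lambda>l. indicator {0<..<1} l * (l powr (A - 1) * (1 - l) powr b) * ?h l)"
      using int unfolding mix_def by (subst (asm) integrable_density) (auto simp: indicator_def)
    then show "set_integrable lborel (einterval (ereal 0) (ereal 1)) ?f"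
      by (simp add: set_integrable_def mult.assoc)
  next
    have "((\<lambda>l. ?F l) \<longlongrightarrow> 0 powr A * (1 - 0) powr (b + 1) * (1 + w * 0) powr (- r)) (at_right 0)"
      using A by (intro tendsto_mult tendsto_powr' tendsto_intros)
        (auto simp: eventually_at_right_less intro: eventually_mono[OF eventually_at_right_less])
    then show "((?F \<circ> real_of_ereal) \<longlongrightarrow> 0) (at_right (ereal 0))"
      using A by (simp add: ereal_tendsto_simps)
  next
    have "((\<lambda>l. ?F l) \<longlongrightarrow> 1 powr A * (1 - 1) powr (b + 1) * (1 + w * 1) powr (- r)) (at_left 1)"
      using b w by (intro tendsto_mult tendsto_powr' tendsto_intros)
        (auto intro!: eventually_mono[OF eventually_at_left_real[of 0 1]])
    then show "((?F \<circ> real_of_ereal) \<longlongrightarrow> 0) (at_left (ereal 1))"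
      using b by (simp add: ereal_tendsto_simps)
  qed simp
  moreover have "(\<integral>l. ?h l \<partial>mix) = (LBINT l=0..1. ?f l)"
    by (rule integral_mix) measurable
  ultimately show ?thesis by (simp add: zero_ereal_def one_ereal_def)
qed

section \<open>The shrinkage function and its differential equation\<close>

abbreviation k :: real where "k \<equiv> A + m + 1"

definition \<phi> :: "real \<Rightarrow> real" where
  "\<phi> w = w * mom 1 k w / mom 0 k w"

text \<open>This is the Riccati equation solved for the derivative, so \<open>riccati\<close> holds
  by definition; the content is in \<open>\<phi>_deriv\<close>.\<close>

definition \<phi>' :: "real \<Rightarrow> real" where
  "\<phi>' w = ((A - m * \<phi> w) * (w - \<phi> w) - b * \<phi> w * (1 + \<phi> w)) / (w * (1 + w))"

lemma mix_pos:
  fixes f :: "real \<Rightarrow> real"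
  shows "integrable mix f \<Longrightarrow> (\<And>l. 0 < l \<Longrightarrow> l < 1 \<Longrightarrow> f l > 0) \<Longrightarrow> (\<integral>l. f l \<partial>mix) > 0"
proof -
  assume int: "integrable mix f" and pos: "\<And>l. 0 < l \<Longrightarrow> l < 1 \<Longrightarrow> f l > 0"
  have ae: "AE l in mix. 0 < f l" using AE_mix pos by (auto elim: eventually_mono)
  have ae0: "AE l in mix. 0 \<le> f l" using ae by eventually_elim simp
  have nn: "(\<integral>l. f l \<partial>mix) \<ge> 0" using ae0 by (rule integral_nonneg_AE)
  have "(\<integral>l. f l \<partial>mix) \<noteq> 0"
  proof
    assume "(\<integral>l. f l \<partial>mix) = 0"
    then have "AE l in mix. f l = 0"
      using integral_nonneg_eq_0_iff_AE[OF int ae0] by simp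
    with ae have "AE l in mix. False" by eventually_elim simp
    then have "AE l in lborel. (l::real) \<notin> {0<..<1}"
      unfolding mix_def by (subst (asm) AE_density) (auto simp: indicator_def elim!: eventually_mono split: if_splits)
    then have "emeasure lborel {l::real. \<not> l \<notin> {0<..<1}} = 0"
      by (subst (asm) AE_iff_measurable[OF _ refl]) auto
    moreover have "{l::real. \<not> l \<notin> {0<..<1}} = {0<..<1}" by auto
    ultimately show False by simp
  qed
  with nn show ?thesis by simp
qed

lemma mom_pos: "w \<ge> 0 \<Longrightarrow> r \<ge> 0 \<Longrightarrow> mom i r w > 0"
  unfolding mom_def
proof (rule mix_pos)
  fix l :: real assume "w \<ge> 0" "0 < l"
  then have "1 + w * l > 0" by (simp add: add_pos_nonneg)
  with \<open>0 < l\<close> show "l ^ i * (1 + w * l) powr (- r) > 0" by simp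
qed (rule mom_integrable)

lemma k_pos: "k > 0" using A m by simp

lemma powr_Suc_neg: "1 + w * l > 0 \<Longrightarrow> (1 + w * l) powr (- r) = (1 + w * l) * (1 + w * l) powr (- (r + 1))" for w l r :: real
  using powr_add[of "1 + w * l" "- (r + 1)" 1] by simp

lemma has_mom:
  "w \<ge> 0 \<Longrightarrow> r \<ge> 0 \<Longrightarrow> has_bochner_integral mix (\<lambda>l. l ^ i * (1 + w * l) powr (- r)) (mom i r w)"
  unfolding mom_def by (intro has_bochner_integral_integrable mom_integrable)

lemma mom_shift:
  assumes "w \<ge> 0" "r \<ge> 0" 
  shows "mom i r w = mom i (r + 1) w + w * mom (Suc i) (r + 1) w"
proof -
  have "mom i r w = (\<integral>l. l ^ i * (1 + w * l) powr (- (r + 1)) + w * (l ^ Suc i * (1 + w * l) powr (- (r + 1))) \<partial>mix)"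
    unfolding mom_def
  proof (rule integral_cong_AE)
    show "AE l in mix. l ^ i * (1 + w * l) powr - r =
        l ^ i * (1 + w * l) powr - (r + 1) + w * (l ^ Suc i * (1 + w * l) powr - (r + 1))"
      using AE_mix
    proof eventually_elim
      case (elim l)
      then have "1 + w * l > 0" using assms by (simp add: add_pos_nonneg)
      then show ?case by (simp only: powr_Suc_neg[of w l r]) (simp add: algebra_simps)
    qed
  qed measurable
  also have "\<dots> = mom i (r + 1) w + w * mom (Suc i) (r + 1) w"
    by (intro has_bochner_integral_integral_eq has_bochner_integral_add has_bochner_integral_mult_right
        has_mom) (use assms in auto)
  finally show ?thesis .
qed

text \<open>The polynomial of \<open>by_parts\<close> is sorted by powers of \<open>l\<close>. The
  case \<open>r = k\<close> yields the Riccati equation, the case \<open>r = k - 1\<close> the a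
  priori bounds on \<open>\<phi>\<close>.\<close>

lemma mom_by_parts:
  assumes w: "w > 0" and r: "r \<ge> 0"
  shows "A * mom 0 (r + 1) w + (A * w - A - r * w - (b + 1)) * mom 1 (r + 1) w
       + (r - A - (b + 1)) * w * mom 2 (r + 1) w = 0"
proof -
  let ?g = "\<lambda>i l. l ^ i * (1 + w * l) powr (- (r + 1))"
  have "0 = (\<integral>l. A * ?g 0 l + (A * w - A - r * w - (b + 1)) * ?g 1 l + (r - A - (b + 1)) * w * ?g 2 l \<partial>mix)"
    unfolding by_parts[OF w, of r, symmetric]
    by (rule arg_cong[where f = "integral\<^sup>L mix"]) (auto simp: fun_eq_iff algebra_simps power2_eq_square)
  also have "\<dots> = A * mom 0 (r + 1) w + (A * w - A - r * w - (b + 1)) * mom 1 (r + 1) w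
       + (r - A - (b + 1)) * w * mom 2 (r + 1) w"
    by (intro has_bochner_integral_integral_eq has_bochner_integral_add has_bochner_integral_mult_right
        has_mom) (use w r in auto)
  finally show ?thesis by simp
qed

lemma \<phi>_pos: "w > 0 \<Longrightarrow> \<phi> w > 0"
  unfolding \<phi>_def using mom_pos[of w k] k_pos by simp

lemma \<phi>_less: assumes "w > 0" shows "\<phi> w < w"
proof -
  have "mom 0 k w - mom 1 k w = (\<integral>l. (1 - l) * (1 + w * l) powr (- k) \<partial>mix)"
    unfolding mom_def using assms k_pos mom_integrable[of w k 0] mom_integrable[of w k 1]
    by (subst Bochner_Integration.integral_diff[symmetric]) (auto simp: algebra_simps)
  also have "\<dots> > 0"
  proof (rule mix_pos)
    have "integrable mix (\<lambda>l. l ^ 0 * (1 + w * l) powr (- k) - l ^ 1 * (1 + w * l) powr (- k))"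
      using assms k_pos by (intro Bochner_Integration.integrable_diff mom_integrable) auto
    then show "integrable mix (\<lambda>l. (1 - l) * (1 + w * l) powr (- k))" by (simp add: algebra_simps)
    show "(1 - l) * (1 + w * l) powr (- k) > 0" if "0 < l" "l < 1" for l
      using that assms by (simp add: add_pos_pos less_imp_neq[symmetric])
  qed
  finally show ?thesis
    using assms mom_pos[of w k 0] k_pos by (simp add: \<phi>_def divide_less_eq)
qed

lemma riccati: "w > 0 \<Longrightarrow> w * (1 + w) * \<phi>' w = (A - m * \<phi> w) * (w - \<phi> w) - b * \<phi> w * (1 + \<phi> w)"
  unfolding \<phi>'_def by simp

text \<open>The quotient rule produces moments of exponent \<open>k + 1\<close>. Two shifts and one
  integration by parts are three linear relations expressing \<open>K0\<close>, \<open>K1\<close>,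
  \<open>K2\<close> through \<open>J0\<close> and \<open>J1\<close>; therefore the equation for the
  ratio closes.\<close>

lemma \<phi>_deriv:
  assumes w: "w > 0"
  shows "(\<phi> has_real_derivative \<phi>' w) (at w)"
proof -
  define J0 J1 K0 K1 K2 where "J0 = mom 0 k w" "J1 = mom 1 k w"
    "K0 = mom 0 (k + 1) w" "K1 = mom 1 (k + 1) w" "K2 = mom 2 (k + 1) w"
  note defs = this
  have J0: "J0 > 0" using w k_pos by (simp add: defs mom_pos)
  have s0: "J0 = K0 + w * K1" and s1: "J1 = K1 + w * K2"
    using mom_shift[of w k 0] mom_shift[of w k 1] w k_pos by (simp_all add: defs numeral_2_eq_2)
  have bp: "A * K0 + (A * w - A - k * w - (b + 1)) * K1 + (k - A - (b + 1)) * w * K2 = 0"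
    using mom_by_parts[OF w, of k] k_pos by (simp add: defs)
  have "(\<phi> has_real_derivative ((J1 + w * (- k * K2)) * J0 - w * J1 * (- k * K1)) / (J0 * J0)) (at w)"
    unfolding \<phi>_def[abs_def]
    using mom_deriv[OF w, of k 1] mom_deriv[OF w, of k 0] k_pos J0
    by (auto intro!: derivative_eq_intros simp: defs numeral_2_eq_2)
  moreover have "((J1 + w * (- k * K2)) * J0 - w * J1 * (- k * K1)) / (J0 * J0) = \<phi>' w"
  proof -
    have ph: "w * J1 = \<phi> w * J0" using J0 by (simp add: \<phi>_def defs)
    have "\<phi>' w * (w * (1 + w)) * (J0 * J0) = (A * J0 - m * w * J1) * (w * J0 - w * J1) - b * w * J1 * (J0 + w * J1)"
      using riccati[OF w] ph by algebra
    moreover have "((J1 + w * (- k * K2)) * J0 - w * J1 * (- k * K1)) * (w * (1 + w)) = 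
       (A * J0 - m * w * J1) * (w * J0 - w * J1) - b * w * J1 * (J0 + w * J1)" (is "?L = ?R")
    proof -
      \<comment> \<open>Here \<open>K0 = J0 - w * K1\<close> and \<open>w * K2 = J1 - K1\<close>
        have been substituted into \<open>bp\<close>; the coefficients of \<open>K1\<close> collect
        to k (1 + w).\<close>
      have "k * (1 + w) * K1 = A * J0 + (m - b) * J1"
        using bp unfolding s0 s1 by (simp add: algebra_simps)
      then have X: "k * (1 + w) * (w * K1) = w * (A * J0 + (m - b) * J1)" by (simp add: mult_ac)
      have "?L = (1 + w) * (w * J1 * J0) + (k * (1 + w) * (w * K1)) * (J0 + w * J1) - k * (1 + w) * (w * J1 * J0)"
        unfolding s0 s1 by (simp add: algebra_simps)
      also have "\<dots> = ?R" unfolding X by (simp add: algebra_simps)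
      finally show ?thesis .
    qed
    ultimately have "\<phi>' w * (J0 * J0) * (w * (1 + w)) = ((J1 + w * (- k * K2)) * J0 - w * J1 * (- k * K1)) * (w * (1 + w))"
      by (simp add: mult_ac)
    then have "\<phi>' w * (J0 * J0) = ((J1 + w * (- k * K2)) * J0 - w * J1 * (- k * K1))"
      using w by (simp add: add_pos_pos less_imp_neq[symmetric])
    then show ?thesis using J0 by (simp add: field_simps)
  qed
  ultimately show ?thesis by simp
qed

text \<open>Taking \<open>r = A + m\<close>, one below \<open>k\<close>, keeps all moments at
  exponent \<open>k\<close>. Only the second moment is foreign to \<open>\<phi>\<close>, and its
  coefficient has the sign of m - (b + 1), which separates the next two bounds.\<close>

lemma mom2_eq:
  assumes w: "w > 0"
  shows "A * w * mom 0 k w - (A + (b + 1) + m * w) * (w * mom 1 k w) + (m - (b + 1)) * w * (w * mom 2 k w) = 0"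
proof -
  have "A * mom 0 k w + (A * w - A - (A + m) * w - (b + 1)) * mom 1 k w + (m - (b + 1)) * w * mom 2 k w = 0"
    using mom_by_parts[OF w, of "A + m"] A m by (simp add: algebra_simps)
  then have "w * (A * mom 0 k w + (A * w - A - (A + m) * w - (b + 1)) * mom 1 k w + (m - (b + 1)) * w * mom 2 k w) = 0"
    by simp
  then show ?thesis by (simp add: algebra_simps)
qed

lemma mom2_le: assumes "w > 0" shows "mom 2 k w \<le> mom 1 k w"
  unfolding mom_def
proof (rule integral_mono_AE)
  show "AE l in mix. l\<^sup>2 * (1 + w * l) powr - k \<le> l ^ 1 * (1 + w * l) powr - k"
    using AE_mix by eventually_elim (intro mult_right_mono power_decreasing, auto)
qed (rule mom_integrable; use assms k_pos in simp)+

text \<open>The second moment enters \<open>mom2_eq\<close> with nonpositive coefficient and can be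
  discarded. This handles negative \<open>b\<close> in (i).\<close>

lemma \<phi>_le_of_b_large:
  assumes "w > 0" "m \<le> b + 1"
  shows "m * \<phi> w \<le> A"
proof -
  have p: "mom 0 k w > 0" "mom 1 k w > 0" "mom 2 k w > 0" using assms k_pos by (auto intro!: mom_pos)
  have "0 \<le> (b + 1 - m) * w * (w * mom 2 k w)" using assms p by simp
  moreover have "0 \<le> (A + (b + 1)) * (w * mom 1 k w)" using assms p A b by simp
  ultimately have "m * w * (w * mom 1 k w) \<le> A * w * mom 0 k w"
    using mom2_eq[OF assms(1)] by (simp add: algebra_simps)
  then have "w * (m * w * mom 1 k w) \<le> w * (A * mom 0 k w)" by (simp add: mult_ac)
  then have "m * w * mom 1 k w \<le> A * mom 0 k w" using assms by simp
  then show ?thesis using p by (simp add: \<phi>_def divide_le_eq mult_ac)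
qed

text \<open>Now the coefficient of the second moment is nonnegative, so that moment is replaced by
  the larger first one. The bound is informative both as \<open>w\<close> tends to 0 and at
  infinity.\<close>

lemma \<phi>_bound:
  assumes "w > 0" "b + 1 \<le> m"
  shows "\<phi> w * ((b + 1) * w + A + (b + 1)) \<le> A * w"
proof -
  have p: "mom 0 k w > 0" "mom 1 k w > 0" using assms k_pos by (auto intro!: mom_pos)
  have "(m - (b + 1)) * w * (w * mom 2 k w) \<le> (m - (b + 1)) * w * (w * mom 1 k w)"
    using assms mom2_le[of w] by (intro mult_left_mono) auto
  with mom2_eq[OF assms(1)] have "(w * mom 1 k w) * ((b + 1) * w + A + (b + 1)) \<le> A * w * mom 0 k w"
    by (simp add: algebra_simps)
  then show ?thesis using p by (simp add: \<phi>_def divide_le_eq mult_ac)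
qed

section \<open>Bounds on the shrinkage function\<close>

text \<open>Above A / m both terms of the Riccati equation are nonpositive, so \<open>\<phi>\<close>
  cannot climb further. For \<open>b = 0\<close> the derivative vanishes on the barrier itself,
  whence the weak form. The start \<open>r \<le> A / m\<close> works because
  \<open>\<phi> r < r\<close>.\<close>

lemma \<phi>_le_of_b_nonneg:
  assumes "w > 0" "b \<ge> 0"
  shows "m * \<phi> w \<le> A"
proof -
  define r where "r = min w (A / m)"
  have r: "r > 0" "r \<le> w" "m * r \<le> A"
    using assms A m by (auto simp: r_def min_def field_simps)
  have "A - m * \<phi> w \<ge> 0"
  proof (rule weak_barrier[where g = "\<lambda>u. A - m * \<phi> u" and g' = "\<lambda>u. - m * \<phi>' u", OF r(2)])
    fix u assume u: "r \<le> u" "u \<le> w"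
    then have u0: "u > 0" using r by simp
    show "((\<lambda>u. A - m * \<phi> u) has_real_derivative - m * \<phi>' u) (at u)"
      by (auto intro!: derivative_eq_intros \<phi>_deriv[OF u0])
    assume neg: "A - m * \<phi> u < 0"
    have "(A - m * \<phi> u) * (u - \<phi> u) \<le> 0"
      using neg \<phi>_less[OF u0] by (simp add: mult_nonpos_nonneg)
    moreover have "b * \<phi> u * (1 + \<phi> u) \<ge> 0" using assms \<phi>_pos[OF u0] by simp
    ultimately have "\<phi>' u \<le> 0"
      unfolding \<phi>'_def using u0 by (intro divide_nonpos_pos) auto
    then show "- m * \<phi>' u \<ge> 0" using m by (simp add: mult_le_0_iff)
  next
    have "m * \<phi> r \<le> m * r" using \<phi>_less[OF r(1)] m by simp
    with r(3) show "A - m * \<phi> r \<ge> 0" by simp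
  qed
  then show ?thesis by simp
qed

text \<open>The numerator \<open>V\<close> of \<open>\<phi>'\<close> satisfies V' = A - m \<phi> > 0
  at its zeros when \<open>b > 0\<close>, so once nonnegative it stays so. If \<open>V w\<close>
  were negative, \<open>\<phi>\<close> would be nonincreasing on all of (0,w], which is incompatible
  with \<open>\<phi> u < u\<close> near 0.\<close>

lemma \<phi>'_nonneg_of_b_nonneg:
  assumes w: "w > 0" and b0: "b \<ge> 0"
  shows "\<phi>' w \<ge> 0"
proof (cases "b = 0")
  case True
  then show ?thesis
    unfolding \<phi>'_def using \<phi>_le_of_b_nonneg[OF w b0] \<phi>_less[OF w] w by simp
next
  case False
  with b0 have bp: "b > 0" by simp
  define V where "V u = (A - m * \<phi> u) * (u - \<phi> u) - b * \<phi> u * (1 + \<phi> u)" for u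
  define V' where "V' u = - m * \<phi>' u * (u - \<phi> u) + (A - m * \<phi> u) * (1 - \<phi>' u)
      - b * (\<phi>' u * (1 + \<phi> u) + \<phi> u * \<phi>' u)" for u
  have dV: "(V has_real_derivative V' u) (at u)" if "u > 0" for u
    unfolding V_def[abs_def] V'_def
    by (auto intro!: derivative_eq_intros \<phi>_deriv[OF that] simp: algebra_simps)
  have keep: "V s \<ge> 0" if "0 < r" "r \<le> s" "V r \<ge> 0" for r s
  proof (rule strict_barrier[where g = V and g' = V', OF that(2) dV that(3)])
    fix u assume u: "r \<le> u" "u \<le> s" and V0: "V u = 0"
    then have u0: "u > 0" using that by simp
    have d0: "\<phi>' u = 0" using V0 by (simp add: V_def \<phi>'_def)
    have "(A - m * \<phi> u) * (u - \<phi> u) > 0"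
      using V0 bp \<phi>_pos[OF u0] by (simp add: V_def)
    then have "A - m * \<phi> u > 0" using \<phi>_less[OF u0] by (simp add: zero_less_mult_iff)
    then show "V' u > 0" by (simp add: V'_def d0)
  qed (use that in auto)
  have "V w \<ge> 0"
  proof (rule ccontr)
    assume neg: "\<not> V w \<ge> 0"
    \<comment> \<open>At this point monotonicity would give
      \<open>\<phi> r \<ge> \<phi> w \<ge> r\<close>.\<close>
    define r where "r = min w (\<phi> w)"
    have r: "0 < r" "r \<le> w" "r \<le> \<phi> w" using w \<phi>_pos[OF w] by (auto simp: r_def)
    have "\<phi> w \<le> \<phi> r"
    proof (rule DERIV_nonpos_imp_nonincreasing[OF r(2)])
      fix u assume u: "r \<le> u" "u \<le> w"
      then have u0: "u > 0" using r by simp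
      have "V u < 0" using keep[OF u0 u(2)] neg by (cases "V u \<ge> 0") auto
      then have "\<phi>' u \<le> 0"
        unfolding \<phi>'_def V_def using u0 by (intro divide_nonpos_pos) auto
      with \<phi>_deriv[OF u0] show "\<exists>y. (\<phi> has_real_derivative y) (at u) \<and> y \<le> 0" by blast
    qed
    with r \<phi>_less[OF r(1)] show False by simp
  qed
  then show ?thesis unfolding \<phi>'_def V_def using w by simp
qed

lemma \<phi>_monotone_case:
  assumes w: "w > 0" and "b \<ge> min (m - 1) 0"
  shows "m * \<phi> w \<le> A" and "\<phi>' w \<ge> 0"
proof -
  show le: "m * \<phi> w \<le> A"
    using assms \<phi>_le_of_b_nonneg[OF w] \<phi>_le_of_b_large[OF w] by (cases "b \<ge> 0") auto
  show "\<phi>' w \<ge> 0"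
  proof (cases "b \<ge> 0")
    case True
    then show ?thesis by (rule \<phi>'_nonneg_of_b_nonneg[OF w])
  next
    case False
    then have "b * \<phi> w * (1 + \<phi> w) \<le> 0"
      using \<phi>_pos[OF w] by (simp add: mult_nonpos_nonneg)
    moreover have "(A - m * \<phi> w) * (w - \<phi> w) \<ge> 0" using le \<phi>_less[OF w] by simp
    ultimately show ?thesis unfolding \<phi>'_def using w by (intro divide_nonneg_pos) auto
  qed
qed

section \<open>The reciprocal of the shrinkage function for negative \<open>b\<close>\<close>

text \<open>
  Bounding \<open>\<phi>\<close> from above is bounding its reciprocal from below; the Riccati equation is
  inherited by \<open>\<zeta> = A / \<phi>\<close>.
\<close>

definition \<zeta> :: "real \<Rightarrow> real" where "\<zeta> w = A / \<phi> w"

definition \<zeta>' :: "real \<Rightarrow> real" where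
  "\<zeta>' w = - ((\<zeta> w - m) * (\<zeta> w * w - A) + (- b) * (\<zeta> w + A)) / (w * (1 + w))"

lemma \<zeta>_deriv:
  assumes w: "w > 0"
  shows "(\<zeta> has_real_derivative \<zeta>' w) (at w)"
proof -
  note p = \<phi>_pos[OF w]
  have "(\<zeta> has_real_derivative - A * \<phi>' w / (\<phi> w * \<phi> w)) (at w)"
    unfolding \<zeta>_def[abs_def] using p by (auto intro!: derivative_eq_intros \<phi>_deriv[OF w])
  moreover have "- A * \<phi>' w / (\<phi> w * \<phi> w) = \<zeta>' w"
  proof -
    have zp: "\<zeta> w * \<phi> w = A" using p by (simp add: \<zeta>_def)
    have e: "((\<zeta> w - m) * (\<zeta> w * w - A) + (- b) * (\<zeta> w + A)) * (\<phi> w * \<phi> w)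
        = A * ((A - m * \<phi> w) * (w - \<phi> w) - b * \<phi> w * (1 + \<phi> w))"
    proof -
      have "((\<zeta> w - m) * (\<zeta> w * w - A) + (- b) * (\<zeta> w + A)) * (\<phi> w * \<phi> w) =
          (\<zeta> w * \<phi> w - m * \<phi> w) * ((\<zeta> w * \<phi> w) * w - A * \<phi> w) - b * ((\<zeta> w * \<phi> w) * \<phi> w + A * \<phi> w * \<phi> w)"
        by (simp add: algebra_simps)
      also have "\<dots> = A * ((A - m * \<phi> w) * (w - \<phi> w) - b * \<phi> w * (1 + \<phi> w))"
        unfolding zp by (simp add: algebra_simps)
      finally show ?thesis .
    qed
    have "\<zeta>' w = - (A * ((A - m * \<phi> w) * (w - \<phi> w) - b * \<phi> w * (1 + \<phi> w)) / (\<phi> w * \<phi> w)) / (w * (1 + w))"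
      unfolding e[symmetric] \<zeta>'_def using p by simp
    then show ?thesis by (simp add: \<phi>'_def)
  qed
  ultimately show ?thesis by simp
qed

lemma \<zeta>_lower:
  assumes w: "w > 0" and bm: "b + 1 \<le> m"
  shows "\<zeta> w * w \<ge> (b + 1) * w + A + (b + 1)"
proof -
  have "\<phi> w * ((b + 1) * w + A + (b + 1)) \<le> A * w" by (rule \<phi>_bound[OF assms])
  then show ?thesis using \<phi>_pos[OF w] by (simp add: \<zeta>_def field_simps)
qed

text \<open>At the level C = m + b (A + m) the numerator of \<open>\<zeta>'\<close> factors as - b
  (A + m) (\<zeta> w - A - (b + 1)), and \<open>\<zeta>_lower\<close> makes the last factor
  positive. So C is a strict barrier from below.\<close>

lemma \<zeta>_lower_const:
  assumes w: "w > 0" and bm: "b + 1 \<le> m" and b0: "b < 0"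
  shows "\<zeta> w \<ge> m + b * (A + m)"
proof -
  define C where "C = m + b * (A + m)"
  \<comment> \<open>By \<open>\<zeta>_lower\<close> the product \<open>\<zeta> r * r\<close> exceeds
    A + (b + 1), so \<open>\<zeta>\<close> is above C for \<open>r\<close> this small.\<close>
  define r where "r = min w ((A + (b + 1)) / (\<bar>C\<bar> + 1))"
  have Ab: "A + (b + 1) > 0" using A b by simp
  have r: "0 < r" "r \<le> w" using w Ab by (auto simp: r_def)
  have "r \<le> (A + (b + 1)) / (\<bar>C\<bar> + 1)" by (simp add: r_def)
  moreover have "\<bar>C\<bar> + 1 > 0" by simp
  ultimately have "(\<bar>C\<bar> + 1) * r \<le> A + (b + 1)"
    by (simp add: pos_le_divide_eq mult.commute)
  moreover have "\<zeta> r * r \<ge> (b + 1) * r + A + (b + 1)" by (rule \<zeta>_lower[OF r(1) bm])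
  moreover have "(b + 1) * r > 0" using b r by simp
  ultimately have "(\<bar>C\<bar> + 1) * r \<le> \<zeta> r * r" by linarith
  then have start: "\<zeta> r \<ge> C" using r by simp
  have "\<zeta> w - C \<ge> 0"
  proof (rule strict_barrier[where g = "\<lambda>u. \<zeta> u - C" and g' = \<zeta>', OF r(2)])
    fix u assume u: "r \<le> u" "u \<le> w"
    then have u0: "u > 0" using r by simp
    show "((\<lambda>u. \<zeta> u - C) has_real_derivative \<zeta>' u) (at u)"
      by (auto intro!: derivative_eq_intros \<zeta>_deriv[OF u0])
    assume eq: "\<zeta> u - C = 0"
    have e: "- ((\<zeta> u - m) * (\<zeta> u * u - A) + (- b) * (\<zeta> u + A)) = (- b) * (A + m) * (\<zeta> u * u - A - (b + 1))"
      using eq unfolding C_def by algebra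
    have "(b + 1) * u > 0" using b u0 by simp
    then have "\<zeta> u * u - A - (b + 1) > 0" using \<zeta>_lower[OF u0 bm] by linarith
    then have "(- b) * (A + m) * (\<zeta> u * u - A - (b + 1)) > 0"
      using b0 A m by (intro mult_pos_pos) auto
    then show "\<zeta>' u > 0" unfolding \<zeta>'_def e using u0 by (intro divide_pos_pos) auto
  qed (use start in auto)
  then show ?thesis by (simp add: C_def)
qed

text \<open>By the Riccati equation the claim is equivalent to \<open>main\<close>. Only the range
  \<phi> > al matters; there \<open>\<phi>\<close> may be replaced by \<open>al\<close> in w -
  \<phi> and in 1 + \<phi>, which makes the inequality harder. Solved for \<open>\<zeta>\<close> it
  becomes the curve of \<open>barrier_polynomial\<close>, and \<open>K\<close> is the constant with
  T (w - al) + K = T (1 + w) + (1 + al).\<close>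

lemma \<phi>'_lower:
  assumes w: "w > 0" and bm: "b + 1 < m" and b0: "b < 0"
  shows "w * \<phi>' w \<ge> b * (A + 1) / (b + 1) * \<phi> w"
proof -
  define t where "t = - b"
  define T where "T = (A + 1) / (b + 1)"
  define al where "al = A / m"
  define M where "M = A + m"
  define K where "K = (T + 1) * (1 + al)"
  have t: "0 < t" "t < 1" using b b0 by (auto simp: t_def)
  have T: "(1 - t) * T = A + 1" using b by (simp add: T_def t_def field_simps)
  have T0: "T > 0" using A b by (simp add: T_def)
  have al: "al > 0" "A = al * m" using A m by (auto simp: al_def)
  have K0: "K > 0" using T0 al by (simp add: K_def)
  note p = \<phi>_pos[OF w] and lt = \<phi>_less[OF w]
  have zp: "\<zeta> w * \<phi> w = A" using p by (simp add: \<zeta>_def)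
  have main: "(m - \<zeta> w) * (w - \<phi> w) \<le> t * T * (1 + w) + t * (1 + \<phi> w)"
  proof (cases "\<zeta> w \<ge> m")
    case True
    then have "(m - \<zeta> w) * (w - \<phi> w) \<le> 0" using lt by (simp add: mult_nonpos_nonneg)
    moreover have "t * T * (1 + w) + t * (1 + \<phi> w) \<ge> 0" using t T0 w p by simp
    ultimately show ?thesis by linarith
  next
    case False
    then have "\<zeta> w * \<phi> w < m * \<phi> w" using p by simp
    then have pal: "\<phi> w > al" using zp m by (simp add: al_def divide_less_eq mult.commute)
    then have wal: "w > al" using lt by simp
    have "m - \<zeta> w \<le> t * (T + K / (w - al))"
    proof (rule ccontr)
      assume "\<not> m - \<zeta> w \<le> t * (T + K / (w - al))"
      then have neg: "\<zeta> w - m + t * (T + K / (w - al)) < 0" by simp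
      have "\<zeta> w \<ge> m - t * M" using \<zeta>_lower_const[OF w _ b0] bm by (simp add: t_def M_def)
      with neg have "t * (T + K / (w - al)) < t * M" by linarith
      then have TM: "K / (w - al) < M - T" using t by simp
      moreover have "K / (w - al) > 0" using K0 wal by simp
      ultimately have MT: "M - T > 0" by linarith
      \<comment> \<open>The curve meets the constant lower bound m - t M of
        \<open>\<zeta>_lower_const\<close> at this point, so the barrier can start here. A violation
        at \<open>w\<close> gives both \<open>M > T\<close> and \<open>r \<le> w\<close>.\<close>
      define r where "r = al + K / (M - T)"
      have r_al: "r > al" using K0 MT by (simp add: r_def)
      have r: "r > 0" "r \<le> w" using r_al al TM wal MT by (simp, simp add: r_def field_simps)
      have "\<zeta> w - m + t * (T + K / (w - al)) \<ge> 0"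
      proof (rule strict_barrier[where g = "\<lambda>u. \<zeta> u - m + t * (T + K / (u - al))"
            and g' = "\<lambda>u. \<zeta>' u - t * (K / (u - al)\<^sup>2)", OF r(2)])
        fix u assume u: "r \<le> u" "u \<le> w"
        then have u0: "u > 0" and ual: "u > al" using r r_al by auto
        show "((\<lambda>u. \<zeta> u - m + t * (T + K / (u - al))) has_real_derivative \<zeta>' u - t * (K / (u - al)\<^sup>2)) (at u)"
          using ual by (auto intro!: derivative_eq_intros \<zeta>_deriv[OF u0] simp: power2_eq_square)
        assume eq: "\<zeta> u - m + t * (T + K / (u - al)) = 0"
        define y where "y = T + K / (u - al)"
        have z: "\<zeta> u = m - t * y" using eq by (simp add: y_def)
        have "K / (u - al) \<le> K / (r - al)"
          using u r_al ual K0 by (intro divide_left_mono) auto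
        also have "\<dots> = M - T" using MT K0 by (simp add: r_def)
        finally have yM: "y \<le> M" by (simp add: y_def)
        have "y * (\<zeta> u * u - A) - (\<zeta> u + A) > K * u * (1 + u) / (u - al)\<^sup>2"
          using barrier_polynomial[OF A m t T, of u y "\<zeta> u"] ual yM z
          by (simp add: al_def M_def K_def y_def)
        then have "t * (y * (\<zeta> u * u - A) - (\<zeta> u + A)) > t * (K * u * (1 + u) / (u - al)\<^sup>2)"
          using t by (intro mult_strict_left_mono)
        also have "t * (y * (\<zeta> u * u - A) - (\<zeta> u + A)) = \<zeta>' u * (u * (1 + u))"
        proof -
          have "\<zeta>' u * (u * (1 + u)) = - ((\<zeta> u - m) * (\<zeta> u * u - A) + (- b) * (\<zeta> u + A))"
            unfolding \<zeta>'_def using u0 by simp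
          then show ?thesis unfolding z by (simp add: t_def algebra_simps)
        qed
        finally have "t * (K / (u - al)\<^sup>2) * (u * (1 + u)) < \<zeta>' u * (u * (1 + u))"
          by (simp add: mult_ac)
        moreover have "u * (1 + u) > 0" using u0 by simp
        ultimately have "t * (K / (u - al)\<^sup>2) < \<zeta>' u" using mult_less_cancel_right_pos by blast
        then show "\<zeta>' u - t * (K / (u - al)\<^sup>2) > 0" by simp
      next
        have "\<zeta> r \<ge> m - t * M" using \<zeta>_lower_const[OF r(1) _ b0] bm by (simp add: t_def M_def)
        moreover have "K / (r - al) = M - T" using MT K0 by (simp add: r_def)
        ultimately show "\<zeta> r - m + t * (T + K / (r - al)) \<ge> 0" by simp
      qed
      with neg show False by simp
    qed
    then have "(m - \<zeta> w) * (w - al) \<le> t * (T + K / (w - al)) * (w - al)"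
      using wal by (intro mult_right_mono) auto
    also have "\<dots> = t * (T * (w - al) + K)" using wal by (simp add: field_simps)
    also have "\<dots> = t * T * (1 + w) + t * (1 + al)" by (simp add: K_def algebra_simps)
    also have "\<dots> \<le> t * T * (1 + w) + t * (1 + \<phi> w)" using t pal by simp
    finally have "(m - \<zeta> w) * (w - al) \<le> t * T * (1 + w) + t * (1 + \<phi> w)" .
    moreover have "(m - \<zeta> w) * (w - \<phi> w) \<le> (m - \<zeta> w) * (w - al)"
      using False pal by (intro mult_left_mono) auto
    ultimately show ?thesis by linarith
  qed
  have "(m - \<zeta> w) * (w - \<phi> w) * \<phi> w = (m * \<phi> w - \<zeta> w * \<phi> w) * (w - \<phi> w)"
    by (simp add: algebra_simps)
  then have "(m * \<phi> w - A) * (w - \<phi> w) = (m - \<zeta> w) * (w - \<phi> w) * \<phi> w"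
    by (simp only: zp)
  also have "\<dots> \<le> (t * T * (1 + w) + t * (1 + \<phi> w)) * \<phi> w"
    using main p by (intro mult_right_mono) auto
  finally have "(A - m * \<phi> w) * (w - \<phi> w) - b * \<phi> w * (1 + \<phi> w) \<ge> - (t * T * \<phi> w) * (1 + w)"
    by (simp add: t_def algebra_simps)
  then have "w * (1 + w) * \<phi>' w \<ge> - (t * T * \<phi> w) * (1 + w)" unfolding riccati[OF w] .
  then have "(w * \<phi>' w) * (1 + w) \<ge> - (t * T * \<phi> w) * (1 + w)" by (simp add: mult_ac)
  then have "w * \<phi>' w \<ge> - (t * T * \<phi> w)" by (rule mult_right_le_imp_le) (use w in simp)
  then show ?thesis by (simp add: t_def T_def)
qed

text \<open>\<open>\<zeta>_lower_const\<close> multiplied by \<open>\<phi> w\<close>. Since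
  \<alpha>/(1 + \<alpha>) = A / (A + m), this is the upper bound on \<phi>/(1 + \<phi>).\<close>

lemma \<phi>_fraction_le:
  assumes w: "w > 0" and bm: "b + 1 < m" and b0: "b < 0"
  shows "(b + 1) * (A + m) * \<phi> w \<le> A * (1 + \<phi> w)"
proof -
  have "\<zeta> w * \<phi> w \<ge> (m + b * (A + m)) * \<phi> w"
    using \<zeta>_lower_const[OF w _ b0] bm \<phi>_pos[OF w] by (intro mult_right_mono) auto
  then have "A \<ge> (m + b * (A + m)) * \<phi> w" using \<phi>_pos[OF w] by (simp add: \<zeta>_def)
  then show ?thesis by (simp add: algebra_simps)
qed

section \<open>The differential inequality for the risk\<close>

lemma risk_inequality_monotone:
  assumes w: "w > 0" and "b \<ge> min (m - 1) 0" and c: "A \<le> c * m" and \<nu>: "\<nu> \<ge> 0"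
  shows "\<nu> * (c - \<phi> w) * \<phi> w + 4 * (1 + \<phi> w) * (w * \<phi>' w) \<ge> 0"
proof -
  have "m * \<phi> w \<le> m * c" using \<phi>_monotone_case(1)[OF assms(1,2)] c by (simp add: mult.commute)
  then have "\<phi> w \<le> c" using m by simp
  then show ?thesis using \<phi>_monotone_case(2)[OF assms(1,2)] \<phi>_pos[OF w] w \<nu> by simp
qed

text \<open>In the application \<open>\<nu>\<close> = n + 2 and \<open>h\<close> = (p - 2)/2, so A +
  1 + h = p + a + 1. The fraction bound, weighted by 4 h + \<nu>, and the bound on w \<phi>',
  weighted by 4 (1 + \<phi>), are added.\<close>

lemma risk_inequality_negative:
  assumes w: "w > 0" and bm: "b + 1 < m" and b0: "b < 0" and \<nu>: "\<nu> \<ge> 0"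
    and h: "4 * h - \<nu> * (A / m) \<ge> - 4 * b * (A + 1 + h) * (1 + A / m)" and c: "\<nu> * c = 4 * h" and h0: "h \<ge> 0"
  shows "\<nu> * (c - \<phi> w) * \<phi> w + 4 * (1 + \<phi> w) * (w * \<phi>' w) \<ge> 0"
proof -
  define T where "T = b * (A + 1) / (b + 1)"
  note p = \<phi>_pos[OF w]
  have beta: "b + 1 > 0" using b by simp
  then have T: "(b + 1) * T = b * (A + 1)" by (simp add: T_def)
  have "m * (4 * h - \<nu> * (A / m)) \<ge> m * (- 4 * b * (A + 1 + h) * (1 + A / m))"
    using h m by (intro mult_left_mono) auto
  then have H: "4 * h * m - \<nu> * A \<ge> - 4 * b * (A + 1 + h) * (A + m)"
    using m by (simp add: algebra_simps add_divide_distrib)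
  have "(4 * h + \<nu>) * ((b + 1) * (A + m) * \<phi> w) \<le> (4 * h + \<nu>) * (A * (1 + \<phi> w))"
    using \<phi>_fraction_le[OF w bm b0] h0 \<nu> by (intro mult_left_mono) auto
  also have "\<dots> \<le> (4 * h * (b + 1) * (A + m) + 4 * b * (A + 1) * (A + m)) * (1 + \<phi> w)"
  proof -
    have "(4 * h + \<nu>) * A \<le> 4 * h * (b + 1) * (A + m) + 4 * b * (A + 1) * (A + m)"
      using H by (simp add: algebra_simps)
    then have "(4 * h + \<nu>) * A * (1 + \<phi> w) \<le> (4 * h * (b + 1) * (A + m) + 4 * b * (A + 1) * (A + m)) * (1 + \<phi> w)"
      using p by (intro mult_right_mono) auto
    then show ?thesis by (simp add: mult.assoc)
  qed
  finally have "(b + 1) * (A + m) * ((4 * h + \<nu>) * \<phi> w) \<le>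
      (b + 1) * (A + m) * ((4 * h + 4 * T) * (1 + \<phi> w))"
  proof -
    have "(b + 1) * (A + m) * ((4 * h + 4 * T) * (1 + \<phi> w)) =
        (4 * h * (b + 1) * (A + m) + 4 * ((b + 1) * T) * (A + m)) * (1 + \<phi> w)"
      by (simp add: algebra_simps)
    then have R: "(b + 1) * (A + m) * ((4 * h + 4 * T) * (1 + \<phi> w)) =
        (4 * h * (b + 1) * (A + m) + 4 * b * (A + 1) * (A + m)) * (1 + \<phi> w)"
      unfolding T by (simp only: mult.assoc)
    have L: "(b + 1) * (A + m) * ((4 * h + \<nu>) * \<phi> w) = (4 * h + \<nu>) * ((b + 1) * (A + m) * \<phi> w)"
      by (simp add: mult_ac)
    assume "(4 * h + \<nu>) * ((b + 1) * (A + m) * \<phi> w)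
      \<le> (4 * h * (b + 1) * (A + m) + 4 * b * (A + 1) * (A + m)) * (1 + \<phi> w)"
    then show ?thesis unfolding L R .
  qed
  then have "(4 * h + \<nu>) * \<phi> w \<le> (4 * h + 4 * T) * (1 + \<phi> w)"
    using beta A m by simp
  then have 1: "4 * h - \<nu> * \<phi> w + 4 * T * (1 + \<phi> w) \<ge> 0"
    by (simp add: algebra_simps)
  have 2: "4 * (1 + \<phi> w) * (w * \<phi>' w) \<ge> 4 * (1 + \<phi> w) * (T * \<phi> w)"
    using \<phi>'_lower[OF w bm b0, folded T_def] p by (intro mult_left_mono) auto
  have "0 \<le> (4 * h - \<nu> * \<phi> w + 4 * T * (1 + \<phi> w)) * \<phi> w"
    using 1 p by simp
  also have "\<dots> = \<nu> * (c - \<phi> w) * \<phi> w + 4 * (1 + \<phi> w) * (T * \<phi> w)"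
    unfolding c[symmetric] by (simp add: algebra_simps)
  finally show ?thesis using 2 by linarith
qed

section \<open>Boundedness, measurability and identification with \<open>phi\<close>\<close>

lemma \<phi>_bounded: "\<exists>B. \<forall>w>0. \<phi> w \<le> B"
proof (cases "b + 1 \<le> m")
  case True
  have "\<phi> w \<le> A / (b + 1)" if w: "w > 0" for w
  proof -
    have "0 < \<phi> w * (A + (b + 1))" using \<phi>_pos[OF w] A b by simp
    then have "\<phi> w * ((b + 1) * w) \<le> A * w" using \<phi>_bound[OF w True] by (simp add: algebra_simps)
    then have "\<phi> w * (b + 1) \<le> A" using w by (simp add: mult_ac)
    then show ?thesis using b by (simp add: le_divide_eq)
  qed
  then show ?thesis by blast
next
  case False
  have "\<phi> w \<le> A / m" if "w > 0" for w
    using \<phi>_le_of_b_large[OF that] False m by (simp add: le_divide_eq mult.commute)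
  then show ?thesis by blast
qed

text \<open>Such bounds supply the dominating constants for Stein's identity. The singular
  denominator w (1 + w) is harmless: \<open>\<phi> w < w\<close> bounds both w - \<phi> and \<phi>
  (1 + \<phi>) by w (1 + w).\<close>

lemma \<phi>'_bounded: "\<exists>B. \<forall>w>0. \<phi> w \<le> B \<and> \<bar>\<phi>' w\<bar> \<le> B"
proof -
  obtain B where B: "\<And>w. w > 0 \<Longrightarrow> \<phi> w \<le> B" using \<phi>_bounded by blast
  have B0: "B \<ge> 0" using B[of 1] \<phi>_pos[of 1] by simp
  define C where "C = B + A + m * B + \<bar>b\<bar>"
  have "\<phi> w \<le> C \<and> \<bar>\<phi>' w\<bar> \<le> C" if w: "w > 0" for w
  proof
    note p = \<phi>_pos[OF w] \<phi>_less[OF w] B[OF w]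
    show "\<phi> w \<le> C" using p B0 A m by (simp add: C_def add_increasing2)
    have q: "w * (1 + w) > 0" using w by simp
    have "\<bar>A - m * \<phi> w\<bar> \<le> A + m * B"
    proof -
      have "m * \<phi> w \<le> m * B" "m * \<phi> w \<ge> 0" using p m by auto
      then show ?thesis using A by linarith
    qed
    moreover have "\<bar>w - \<phi> w\<bar> \<le> w * (1 + w)"
    proof -
      have "w * w \<ge> 0" by simp
      then show ?thesis using p by (simp add: algebra_simps)
    qed
    ultimately have "\<bar>A - m * \<phi> w\<bar> * \<bar>w - \<phi> w\<bar> \<le> (A + m * B) * (w * (1 + w))"
      using A m B0 by (intro mult_mono) auto
    moreover have "\<phi> w * (1 + \<phi> w) \<le> w * (1 + w)" using p w by (intro mult_mono) auto
    then have "\<bar>b\<bar> * (\<phi> w * (1 + \<phi> w)) \<le> \<bar>b\<bar> * (w * (1 + w))" by (rule mult_left_mono) simp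
    ultimately have "\<bar>A - m * \<phi> w\<bar> * \<bar>w - \<phi> w\<bar> + \<bar>b\<bar> * (\<phi> w * (1 + \<phi> w)) \<le> (A + m * B + \<bar>b\<bar>) * (w * (1 + w))"
      by (simp add: algebra_simps)
    moreover have "\<bar>(A - m * \<phi> w) * (w - \<phi> w) - b * \<phi> w * (1 + \<phi> w)\<bar> \<le>
        \<bar>A - m * \<phi> w\<bar> * \<bar>w - \<phi> w\<bar> + \<bar>b\<bar> * (\<phi> w * (1 + \<phi> w))"
      using abs_triangle_ineq4[of "(A - m * \<phi> w) * (w - \<phi> w)" "b * \<phi> w * (1 + \<phi> w)"] p
      by (simp add: abs_mult mult.assoc)
    ultimately have "\<bar>(A - m * \<phi> w) * (w - \<phi> w) - b * \<phi> w * (1 + \<phi> w)\<bar> / (w * (1 + w)) \<le> A + m * B + \<bar>b\<bar>"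
      using q by (subst pos_divide_le_eq) auto
    moreover have "\<bar>\<phi>' w\<bar> = \<bar>(A - m * \<phi> w) * (w - \<phi> w) - b * \<phi> w * (1 + \<phi> w)\<bar> / (w * (1 + w))"
      unfolding \<phi>'_def abs_divide using q by simp
    ultimately show "\<bar>\<phi>' w\<bar> \<le> C" using B0 by (simp add: C_def)
  qed
  then show ?thesis by blast
qed

lemma measurable_\<phi>:
  "(\<lambda>w. if w > 0 then \<phi> w else 0) \<in> borel_measurable borel"
  "(\<lambda>w. if w > 0 then \<phi>' w else 0) \<in> borel_measurable borel"
proof -
  show "(\<lambda>w. if w > 0 then \<phi> w else 0) \<in> borel_measurable borel"
    using \<phi>_deriv DERIV_isCont by (intro measurable_if_positive) blast
  then have [measurable]: "(\<lambda>w. if w > 0 then \<phi> w else 0) \<in> borel_measurable borel" .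
  define F where "F = (\<lambda>w. if w > 0 then \<phi> w else 0)"
  have [measurable]: "F \<in> borel_measurable borel" by (simp add: F_def)
  have "(\<lambda>w. if w > 0 then \<phi>' w else 0) =
      (\<lambda>w. if w > 0 then ((A - m * F w) * (w - F w) - b * F w * (1 + F w)) / (w * (1 + w)) else 0)"
    by (auto simp: F_def \<phi>'_def)
  also have "\<dots> \<in> borel_measurable borel" by measurable
  finally show "(\<lambda>w. if w > 0 then \<phi>' w else 0) \<in> borel_measurable borel" .
qed

lemma phi_eq:
  assumes "A = p/2 + a + 1" "m = n/2 + e - a" and w: "w > 0"
  shows "phi p n a b e w = \<phi> w"
proof -
  have k: "- p/2 - n/2 - e - 2 = - k" using assms by simp
  have "(LBINT l=0..1. l powr (p/2 + a) * (1 - l) powr b * (1 + w * l) powr (- k)) = mom 0 k w"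
    unfolding mom_def using integral_mix[of "\<lambda>l. l ^ 0 * (1 + w * l) powr (- k)"] assms(1)
    by (simp add: mult.assoc)
  moreover have "(LBINT l=0..1. l powr (p/2 + a + 1) * (1 - l) powr b * (1 + w * l) powr (- k)) = mom 1 k w"
  proof -
    have "mom 1 k w = (LBINT l=0..1. l powr (A - 1) * (1 - l) powr b * (l ^ 1 * (1 + w * l) powr (- k)))"
      unfolding mom_def by (rule integral_mix) measurable
    also have "\<dots> = (LBINT l=0..1. l powr (p/2 + a + 1) * (1 - l) powr b * (1 + w * l) powr (- k))"
    proof (rule interval_integral_cong)
      fix l assume "l \<in> einterval (min 0 1) (max 0 1)"
      then have "l > 0" by (auto simp: einterval_def zero_ereal_def)
      then have "l powr (p/2 + a + 1) = l powr (A - 1) * l"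
        using powr_add[of l "A - 1" 1] assms(1) by simp
      then show "l powr (A - 1) * (1 - l) powr b * (l ^ 1 * (1 + w * l) powr (- k)) =
          l powr (p/2 + a + 1) * (1 - l) powr b * (1 + w * l) powr (- k)" by simp
    qed
    finally show ?thesis ..
  qed
  ultimately show ?thesis unfolding phi_def \<phi>_def k by simp
qed

end

section \<open>Stein's identity\<close>

lemma lborel_translation:
  fixes f :: "'a::euclidean_space \<Rightarrow> real"
  assumes f: "integrable lborel f"
  shows "integrable lborel (\<lambda>x. f (x + c))" and "(\<integral>x. f (x + c) \<partial>lborel) = (\<integral>x. f x \<partial>lborel)"
proof -
  have m: "f \<in> borel_measurable borel" using f by auto
  have "integrable (distr lborel borel ((+) c)) f" using f by (simp add: lborel_distr_plus)
  then show "integrable lborel (\<lambda>x. f (x + c))"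
    using m by (subst (asm) integrable_distr_eq) (auto simp: add.commute)
  have "(\<integral>x. f x \<partial>lborel) = (\<integral>x. f x \<partial>distr lborel borel ((+) c))" by (simp add: lborel_distr_plus)
  also have "\<dots> = (\<integral>x. f (x + c) \<partial>lborel)"
    using m by (subst integral_distr) (auto simp: add.commute)
  finally show "(\<integral>x. f (x + c) \<partial>lborel) = (\<integral>x. f x \<partial>lborel)" ..
qed

text \<open>
  By translation invariance \<open>G (x + v) - G x\<close> has integral zero, and it is the integral of \<open>G'\<close> along the
  segment from \<open>x\<close> to \<open>x + v\<close>. No decay at infinity enters.
\<close>

lemma integral_directional_derivative_eq_0:
  fixes G G' :: "'a::euclidean_space \<Rightarrow> real" and v :: 'a
  assumes G: "integrable lborel G" and G': "integrable lborel G'"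
    and line: "AE x in lborel. continuous_on UNIV (\<lambda>s::real. G (x + s *\<^sub>R v)) \<and>
      (\<exists>S. finite S \<and> (\<forall>s. s \<notin> S \<longrightarrow> ((\<lambda>s. G (x + s *\<^sub>R v)) has_real_derivative G' (x + s *\<^sub>R v)) (at s)))"
  shows "(\<integral>x. G' x \<partial>lborel) = 0"
proof -
  have m[measurable]: "G' \<in> borel_measurable borel" using G' by auto
  define F where "F s x = indicator {0..1::real} s * G' (x + s *\<^sub>R v)" for s x
  have meas: "case_prod F \<in> borel_measurable (lborel \<Otimes>\<^sub>M lborel)"
    unfolding F_def by measurable
  have int: "integrable (lborel \<Otimes>\<^sub>M lborel) (case_prod F)"
  proof (rule lborel_pair.Fubini_integrable[OF meas])
    have "(\<lambda>s. \<integral>x. norm (case_prod F (s, x)) \<partial>lborel) = (\<lambda>s. indicator {0..1} s * (\<integral>x. \<bar>G' x\<bar> \<partial>lborel))"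
    proof
      fix s
      have "(\<integral>x. \<bar>G' (x + s *\<^sub>R v)\<bar> \<partial>lborel) = (\<integral>x. \<bar>G' x\<bar> \<partial>lborel)"
        by (rule lborel_translation(2)[of "\<lambda>x. \<bar>G' x\<bar>"]) (use G' in auto)
      then show "(\<integral>x. norm (case_prod F (s, x)) \<partial>lborel) = indicator {0..1} s * (\<integral>x. \<bar>G' x\<bar> \<partial>lborel)"
        by (simp add: F_def abs_mult)
    qed
    then show "integrable lborel (\<lambda>s. \<integral>x. norm (case_prod F (s, x)) \<partial>lborel)"
      by (simp add: integrable_real_indicator)
    show "AE s in lborel. integrable lborel (\<lambda>x. case_prod F (s, x))"
      using lborel_translation(1)[OF G'] by (simp add: F_def)
  qed
  have "(\<integral>x. (\<integral>s. F s x \<partial>lborel) \<partial>lborel) = (\<integral>s. (\<integral>x. F s x \<partial>lborel) \<partial>lborel)"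
    by (rule lborel_pair.Fubini_integral[OF int])
  also have "\<dots> = (\<integral>s. indicator {0..1::real} s * (\<integral>x. G' x \<partial>lborel) \<partial>lborel)"
    using lborel_translation(2)[OF G'] by (simp add: F_def)
  also have "\<dots> = (\<integral>x. G' x \<partial>lborel)" by simp
  finally have 1: "(\<integral>x. (\<integral>s. F s x \<partial>lborel) \<partial>lborel) = (\<integral>x. G' x \<partial>lborel)" .
  have "AE x in lborel. (\<integral>s. F s x \<partial>lborel) = G (x + v) - G x"
    using lborel_pair.AE_integrable_snd[OF int] line
  proof eventually_elim
    case (elim x)
    then obtain S where S: "finite S"
      "\<And>s. s \<notin> S \<Longrightarrow> ((\<lambda>s. G (x + s *\<^sub>R v)) has_real_derivative G' (x + s *\<^sub>R v)) (at s)" by blast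
    \<comment> \<open>This form of the fundamental theorem tolerates a finite exceptional set, since
      a line may pass through the origin, where the shrinkage factor need not be
      differentiable.\<close>
    have "((\<lambda>s. G' (x + s *\<^sub>R v)) has_integral (G (x + 1 *\<^sub>R v) - G (x + 0 *\<^sub>R v))) {0..1}"
    proof (rule fundamental_theorem_of_calculus_interior_strong[OF S(1)])
      show "continuous_on {0..1} (\<lambda>s. G (x + s *\<^sub>R v))" using elim continuous_on_subset by blast
    qed (use S(2) in \<open>auto simp: has_real_derivative_iff_has_vector_derivative\<close>)
    moreover have "set_integrable lborel {0..1} (\<lambda>s. G' (x + s *\<^sub>R v))"
      using elim by (simp add: set_integrable_def F_def)
    then have "((\<lambda>s. G' (x + s *\<^sub>R v)) has_integral (LINT s:{0..1}|lborel. G' (x + s *\<^sub>R v))) {0..1}"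
      by (metis has_integral_integrable_integral set_borel_integral_eq_integral)
    ultimately have "(LINT s:{0..1}|lborel. G' (x + s *\<^sub>R v)) = G (x + v) - G x"
      by (metis has_integral_unique scaleR_one scaleR_zero_left add_0_right)
    then show ?case by (simp add: set_lebesgue_integral_def F_def)
  qed
  moreover have "(\<lambda>x. \<integral>s. F s x \<partial>lborel) \<in> borel_measurable lborel"
    using lborel_pair.integrable_snd[OF int] by auto
  moreover have "(\<lambda>x. G (x + v) - G x) \<in> borel_measurable lborel"
    using G lborel_translation(1)[OF G, of v] by auto
  ultimately have "(\<integral>x. (\<integral>s. F s x \<partial>lborel) \<partial>lborel) = (\<integral>x. G (x + v) - G x \<partial>lborel)"
    by (intro integral_cong_AE)
  also have "\<dots> = 0" using lborel_translation[OF G, of v] G by (simp add: Bochner_Integration.integral_diff)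
  finally show ?thesis using 1 by simp
qed

text \<open>\<open>H1 r\<close> stands for r H'(r), which stays bounded where H' itself may blow up.
  At \<open>q + t\<^sup>2 = 0\<close> nothing is known of \<open>H\<close> but its bound, yet the
  factor \<open>t\<close> still makes the product continuous.\<close>

lemma coordinate_product:
  fixes H H1 E E' :: "real \<Rightarrow> real"
  assumes q: "q \<ge> 0" and H: "\<And>r. r > 0 \<Longrightarrow> (H has_real_derivative H1 r / r) (at r)"
    and B: "\<And>r. \<bar>H r\<bar> \<le> B" and E: "\<And>t. (E has_real_derivative E' t) (at t)"
  defines "g \<equiv> \<lambda>t. t * H (q + t\<^sup>2) * E t"
  shows "continuous_on UNIV g"
    and "q + t\<^sup>2 > 0 \<Longrightarrow>
      (g has_real_derivative (H (q + t\<^sup>2) + 2 * t\<^sup>2 / (q + t\<^sup>2) * H1 (q + t\<^sup>2)) * E t + t * H (q + t\<^sup>2) * E' t) (at t)"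
proof -
  show der: "(g has_real_derivative (H (q + t\<^sup>2) + 2 * t\<^sup>2 / (q + t\<^sup>2) * H1 (q + t\<^sup>2)) * E t + t * H (q + t\<^sup>2) * E' t) (at t)"
    if "q + t\<^sup>2 > 0" for t
  proof -
    have "((\<lambda>t. q + t\<^sup>2) has_real_derivative 2 * t) (at t)"
      by (auto intro!: derivative_eq_intros)
    from DERIV_chain2[OF H[OF that] this]
    have "((\<lambda>t. H (q + t\<^sup>2)) has_real_derivative H1 (q + t\<^sup>2) / (q + t\<^sup>2) * (2 * t)) (at t)" .
    then show ?thesis unfolding g_def
      by (auto intro!: derivative_eq_intros E simp: power2_eq_square algebra_simps)
  qed
  have "isCont g t" for t
  proof (cases "q + t\<^sup>2 > 0")
    case True
    then show ?thesis using der DERIV_isCont by blast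
  next
    case False
    have B0: "B \<ge> 0" using B[of 0] by linarith
    from False have t0: "t = 0" using q by (metis add_nonneg_pos zero_less_power2)
    have "isCont E t" using E DERIV_isCont by blast
    then have "((\<lambda>s. \<bar>s\<bar> * B * \<bar>E s\<bar>) \<longlongrightarrow> \<bar>t\<bar> * B * \<bar>E t\<bar>) (at t)"
      by (intro tendsto_intros) (auto simp: isCont_def)
    then have "((\<lambda>s. \<bar>s\<bar> * B * \<bar>E s\<bar>) \<longlongrightarrow> 0) (at t)" by (simp add: t0)
    then have "(g \<longlongrightarrow> 0) (at t)"
    proof (rule Lim_null_comparison[rotated])
      show "\<forall>\<^sub>F s in at t. norm (g s) \<le> \<bar>s\<bar> * B * \<bar>E s\<bar>"
        using B B0 by (intro always_eventually allI) (auto simp: g_def abs_mult intro!: mult_mono)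
    qed
    then show ?thesis by (simp add: isCont_def g_def t0)
  qed
  then show "continuous_on UNIV g" by (simp add: continuous_on_eq_continuous_at)
qed

lemma measurable_vec_nth [measurable]: "(\<lambda>x::real^'m. x $ i) \<in> borel_measurable borel"
  by (intro borel_measurable_continuous_onI continuous_intros)

lemma norm_sq_axis_line:
  fixes x :: "real^'m"
  shows "(norm (x + s *\<^sub>R axis i 1))\<^sup>2 = ((norm x)\<^sup>2 - (x $ i)\<^sup>2) + (x $ i + s)\<^sup>2"
  unfolding power2_norm_eq_inner
  by (simp add: inner_add_left inner_add_right inner_axis inner_axis' algebra_simps power2_eq_square)

lemma norm_sq_ge_component: "(x $ i)\<^sup>2 \<le> (norm (x :: real^'m))\<^sup>2"
  using component_le_norm_cart[of x i] by (metis abs_ge_zero power2_abs power_mono)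

text \<open>One statement serves both samples: \<open>prj\<close> is \<open>fst\<close> or
  \<open>snd\<close>, and \<open>H\<close>, \<open>H1\<close>, \<open>g\<close> may depend on the
  other component, which is constant along \<open>v\<close>. \<open>G'\<close> is the derivative of
  (prj y)_i H f in direction \<open>v\<close>.\<close>

lemma stein_coordinate:
  fixes prj :: "'a::euclidean_space \<Rightarrow> real^'m" and v :: 'a and \<theta> :: "real^'m"
    and H H1 :: "'a \<Rightarrow> real \<Rightarrow> real" and g f :: "'a \<Rightarrow> real"
  assumes prj_line: "\<And>y s. prj (y + s *\<^sub>R v) = prj y + s *\<^sub>R axis i 1"
    and inv: "\<And>y s. H (y + s *\<^sub>R v) = H y" "\<And>y s. H1 (y + s *\<^sub>R v) = H1 y" "\<And>y s. g (y + s *\<^sub>R v) = g y"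
    and [measurable]: "prj \<in> borel_measurable borel"
      "(\<lambda>y. H y ((norm (prj y))\<^sup>2)) \<in> borel_measurable borel" "(\<lambda>y. H1 y ((norm (prj y))\<^sup>2)) \<in> borel_measurable borel"
    and der: "AE y in lborel. \<forall>r>0. (H y has_real_derivative H1 y r / r) (at r)"
    and B: "\<And>y r. \<bar>H y r\<bar> \<le> B" "\<And>y r. \<bar>H1 y r\<bar> \<le> B"
    and f: "\<And>y. f y = exp (- (norm (prj y - \<theta>))\<^sup>2 / (2 * \<sigma>\<^sup>2)) * g y" and f0: "\<And>y. f y \<ge> 0" and \<sigma>: "\<sigma> > 0"
    and int: "integrable lborel f" "integrable lborel (\<lambda>y. (prj y $ i - \<theta> $ i)\<^sup>2 * f y)"
  defines "G' \<equiv> \<lambda>y. (H y ((norm (prj y))\<^sup>2) + 2 * (prj y $ i)\<^sup>2 / (norm (prj y))\<^sup>2 * H1 y ((norm (prj y))\<^sup>2)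
      - H y ((norm (prj y))\<^sup>2) * (prj y $ i * (prj y $ i - \<theta> $ i)) / \<sigma>\<^sup>2) * f y"
  shows "integrable lborel G'" and "(\<integral>y. G' y \<partial>lborel) = 0"
proof -
  let ?x = "\<lambda>y. prj y $ i" and ?h = "\<lambda>y. H y ((norm (prj y))\<^sup>2)" and ?h1 = "\<lambda>y. H1 y ((norm (prj y))\<^sup>2)"
  define t where "t = \<theta> $ i"
  define G where "G y = ?x y * ?h y * f y" for y
  have [measurable]: "f \<in> borel_measurable borel" using int by auto
  have B0: "B \<ge> 0" using B(1)[of undefined 0] by linarith
  \<comment> \<open>A constant multiple of \<open>D\<close> dominates \<open>G\<close>, and another
    dominates \<open>G'\<close>; only second moments are needed for integrability.\<close>
  define D where "D y = (1 + (?x y - t)\<^sup>2) * f y" for y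
  have intD: "integrable lborel D"
    unfolding D_def t_def using int by (simp add: algebra_simps)
  have sq: "\<bar>u\<bar> \<le> 1 + u\<^sup>2" for u :: real
    by (rule order_trans[of _ "(1 + u\<^sup>2) / 1"]) (use sum_squares_bound[of 1 "\<bar>u\<bar>"] in auto)
  have xb: "\<bar>?x y\<bar> \<le> (1 + \<bar>t\<bar>) * (1 + (?x y - t)\<^sup>2)" for y
  proof -
    have "\<bar>?x y\<bar> \<le> \<bar>?x y - t\<bar> + \<bar>t\<bar>" by linarith
    also have "\<dots> \<le> (1 + (?x y - t)\<^sup>2) + \<bar>t\<bar> * (1 + (?x y - t)\<^sup>2)"
      using sq[of "?x y - t"] by (intro add_mono) (auto simp: algebra_simps)
    finally show ?thesis by (simp add: algebra_simps)
  qed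
  have xxb: "\<bar>?x y * (?x y - t)\<bar> \<le> (1 + \<bar>t\<bar>) * (1 + (?x y - t)\<^sup>2)" for y
  proof -
    have "?x y * (?x y - t) = (?x y - t)\<^sup>2 + t * (?x y - t)" by (simp add: power2_eq_square algebra_simps)
    then have "\<bar>?x y * (?x y - t)\<bar> \<le> (?x y - t)\<^sup>2 + \<bar>t\<bar> * \<bar>?x y - t\<bar>"
      by (metis abs_mult abs_power2 abs_triangle_ineq)
    also have "\<dots> \<le> (1 + (?x y - t)\<^sup>2) + \<bar>t\<bar> * (1 + (?x y - t)\<^sup>2)"
      using sq[of "?x y - t"] by (intro add_mono mult_left_mono) auto
    finally show ?thesis by (simp add: algebra_simps)
  qed
  have intG: "integrable lborel G"
  proof (rule Bochner_Integration.integrable_bound)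
    show "integrable lborel (\<lambda>y. (1 + \<bar>t\<bar>) * B * D y)" using intD by simp
    show "AE y in lborel. norm (G y) \<le> norm ((1 + \<bar>t\<bar>) * B * D y)"
    proof (rule AE_I2)
      fix y
      have "\<bar>?x y\<bar> * \<bar>?h y\<bar> \<le> ((1 + \<bar>t\<bar>) * (1 + (?x y - t)\<^sup>2)) * B"
        using xb[of y] B(1) by (intro mult_mono) auto
      then have "\<bar>?x y\<bar> * \<bar>?h y\<bar> * f y \<le> ((1 + \<bar>t\<bar>) * (1 + (?x y - t)\<^sup>2)) * B * f y"
        using f0 by (intro mult_right_mono)
      then show "norm (G y) \<le> norm ((1 + \<bar>t\<bar>) * B * D y)"
        using f0[of y] B0 by (simp add: G_def D_def abs_mult mult_ac)
    qed
  qed (unfold G_def[abs_def], measurable)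
  define C where "C = B + 2 * B + B * (1 + \<bar>t\<bar>) / \<sigma>\<^sup>2"
  have C0: "C \<ge> 0" using B0 by (simp add: C_def)
  show intG': "integrable lborel G'"
  proof (rule Bochner_Integration.integrable_bound)
    show "integrable lborel (\<lambda>y. C * D y)" using intD by simp
    show "AE y in lborel. norm (G' y) \<le> norm (C * D y)"
    proof (rule AE_I2)
      fix y
      let ?d = "1 + (?x y - t)\<^sup>2"
      have "\<bar>2 * (?x y)\<^sup>2 / (norm (prj y))\<^sup>2 * ?h1 y\<bar> \<le> 2 * B"
      proof -
        have "(?x y)\<^sup>2 / (norm (prj y))\<^sup>2 \<le> 1"
          using norm_sq_ge_component[of "prj y" i] by (auto simp: divide_le_eq_1)
        then have "(?x y)\<^sup>2 / (norm (prj y))\<^sup>2 * \<bar>?h1 y\<bar> \<le> 1 * B"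
          using B(2) by (intro mult_mono) auto
        then show ?thesis by (simp add: abs_mult)
      qed
      moreover have "\<bar>?h y * (?x y * (?x y - t)) / \<sigma>\<^sup>2\<bar> \<le> B * ((1 + \<bar>t\<bar>) * ?d) / \<sigma>\<^sup>2"
      proof -
        have "\<bar>?h y\<bar> * \<bar>?x y * (?x y - t)\<bar> \<le> B * ((1 + \<bar>t\<bar>) * ?d)"
          using xxb[of y] B B0 by (intro mult_mono) auto
        then show ?thesis by (simp add: abs_mult divide_right_mono)
      qed
      ultimately have "\<bar>?h y + 2 * (?x y)\<^sup>2 / (norm (prj y))\<^sup>2 * ?h1 y - ?h y * (?x y * (?x y - t)) / \<sigma>\<^sup>2\<bar>
          \<le> B + 2 * B + B * ((1 + \<bar>t\<bar>) * ?d) / \<sigma>\<^sup>2"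
        using B(1)[of y "(norm (prj y))\<^sup>2"] by linarith
      also have "\<dots> \<le> C * ?d"
      proof -
        have "(B + 2 * B) * 1 \<le> (B + 2 * B) * ?d" using B0 by (intro mult_left_mono) auto
        then show ?thesis by (simp add: C_def algebra_simps add_divide_distrib)
      qed
      finally have "\<bar>?h y + 2 * (?x y)\<^sup>2 / (norm (prj y))\<^sup>2 * ?h1 y - ?h y * (?x y * (?x y - t)) / \<sigma>\<^sup>2\<bar> * f y
          \<le> C * ?d * f y" using f0 by (intro mult_right_mono)
      then show "norm (G' y) \<le> norm (C * D y)"
        using f0[of y] C0 by (simp add: G'_def D_def t_def abs_mult mult_ac)
    qed
  qed (unfold G'_def, measurable)
  show "(\<integral>y. G' y \<partial>lborel) = 0"
  proof (rule integral_directional_derivative_eq_0[OF intG intG'])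
    show "AE y in lborel. continuous_on UNIV (\<lambda>s. G (y + s *\<^sub>R v)) \<and>
      (\<exists>S. finite S \<and> (\<forall>s. s \<notin> S \<longrightarrow> ((\<lambda>s. G (y + s *\<^sub>R v)) has_real_derivative G' (y + s *\<^sub>R v)) (at s)))"
      using der
    proof eventually_elim
      case (elim y)
      \<comment> \<open>\<open>q\<close> and \<open>q'\<close> collect the other coordinates, fixed
        along the line; what remains is the one-variable \<open>coordinate_product\<close>.\<close>
      define q where "q = (norm (prj y))\<^sup>2 - (prj y $ i)\<^sup>2"
      define q' where "q' = (norm (prj y - \<theta>))\<^sup>2 - (prj y $ i - t)\<^sup>2"
      define E where "E u = exp (- (q' + (u - t)\<^sup>2) / (2 * \<sigma>\<^sup>2)) * g y" for u
      define E' where "E' u = - ((u - t) / \<sigma>\<^sup>2) * E u" for u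
      have q0: "q \<ge> 0" using norm_sq_ge_component[of "prj y" i] by (simp add: q_def)
      have dE: "(E has_real_derivative E' u) (at u)" for u
        unfolding E_def[abs_def] E'_def using \<sigma>
        by (auto intro!: derivative_eq_intros simp: field_simps)
      note cp = coordinate_product[of q "H y" "H1 y" B E E', OF q0 _ B(1) dE]
      have n: "(norm (prj (y + s *\<^sub>R v)))\<^sup>2 = q + (prj y $ i + s)\<^sup>2" for s
        by (simp add: prj_line norm_sq_axis_line q_def)
      have c: "prj (y + s *\<^sub>R v) $ i = prj y $ i + s" for s by (simp add: prj_line axis_def)
      have fE: "f (y + s *\<^sub>R v) = E (prj y $ i + s)" for s
      proof -
        have "(norm (prj y + s *\<^sub>R axis i 1 - \<theta>))\<^sup>2 = q' + (prj y $ i + s - t)\<^sup>2"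
          using norm_sq_axis_line[of "prj y - \<theta>" s i] by (simp add: q'_def t_def algebra_simps)
        then show ?thesis by (simp add: f inv prj_line E_def)
      qed
      let ?k = "\<lambda>u. u * H y (q + u\<^sup>2) * E u"
      have Gk: "(\<lambda>s. G (y + s *\<^sub>R v)) = (\<lambda>s. ?k (prj y $ i + s))"
        by (simp add: G_def n c fE inv fun_eq_iff)
      have cont: "continuous_on UNIV (\<lambda>s. G (y + s *\<^sub>R v))"
        unfolding Gk
        by (rule continuous_on_compose2[OF cp(1)]) (use elim in \<open>auto intro!: continuous_intros\<close>)
      have "((\<lambda>s. G (y + s *\<^sub>R v)) has_real_derivative G' (y + s *\<^sub>R v)) (at s)"
        if s: "s \<notin> {- (prj y $ i)}" for s
      proof -
        define u where "u = prj y $ i + s"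
        have "u \<noteq> 0" using s by (auto simp: u_def)
        then have pos: "q + u\<^sup>2 > 0" using q0 by (simp add: add_nonneg_pos)
        have "(?k has_real_derivative (H y (q + u\<^sup>2) + 2 * u\<^sup>2 / (q + u\<^sup>2) * H1 y (q + u\<^sup>2)) * E u + u * H y (q + u\<^sup>2) * E' u) (at u)"
          by (rule cp(2)[OF _ pos]) (use elim in auto)
        moreover have "(H y (q + u\<^sup>2) + 2 * u\<^sup>2 / (q + u\<^sup>2) * H1 y (q + u\<^sup>2)) * E u + u * H y (q + u\<^sup>2) * E' u = G' (y + s *\<^sub>R v)"
          unfolding G'_def n c fE inv E'_def u_def[symmetric] t_def[symmetric] by (simp add: algebra_simps)
        ultimately have "(?k has_real_derivative G' (y + s *\<^sub>R v)) (at (prj y $ i + s))"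
          by (simp add: u_def)
        then show ?thesis unfolding Gk by (simp add: DERIV_shift add.commute)
      qed
      then show ?case using cont by blast
    qed
  qed
qed

text \<open>Summing over the coordinates, the weights (prj y)_i^2 / |prj y|^2 add up to 1 outside
  the null set \<open>prj y = 0\<close>.\<close>

lemma stein_identity:
  fixes prj :: "'a::euclidean_space \<Rightarrow> real^'m" and v :: "'m \<Rightarrow> 'a" and \<theta> :: "real^'m"
    and H H1 :: "'a \<Rightarrow> real \<Rightarrow> real" and g f :: "'a \<Rightarrow> real"
  assumes prj_line: "\<And>i y s. prj (y + s *\<^sub>R v i) = prj y + s *\<^sub>R axis i 1"
    and inv: "\<And>i y s. H (y + s *\<^sub>R v i) = H y" "\<And>i y s. H1 (y + s *\<^sub>R v i) = H1 y" "\<And>i y s. g (y + s *\<^sub>R v i) = g y"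
    and meas: "prj \<in> borel_measurable borel"
      "(\<lambda>y. H y ((norm (prj y))\<^sup>2)) \<in> borel_measurable borel" "(\<lambda>y. H1 y ((norm (prj y))\<^sup>2)) \<in> borel_measurable borel"
    and der: "AE y in lborel. \<forall>r>0. (H y has_real_derivative H1 y r / r) (at r)"
    and nz: "AE y in lborel. prj y \<noteq> 0"
    and B: "\<And>y r. \<bar>H y r\<bar> \<le> B" "\<And>y r. \<bar>H1 y r\<bar> \<le> B"
    and f: "\<And>y. f y = exp (- (norm (prj y - \<theta>))\<^sup>2 / (2 * \<sigma>\<^sup>2)) * g y" "\<And>y. f y \<ge> 0" and \<sigma>: "\<sigma> > 0"
    and int: "integrable lborel f" "\<And>i. integrable lborel (\<lambda>y. (prj y $ i - \<theta> $ i)\<^sup>2 * f y)"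
  shows "has_bochner_integral lborel (\<lambda>y. (CARD('m) * H y ((norm (prj y))\<^sup>2) + 2 * H1 y ((norm (prj y))\<^sup>2)
      - H y ((norm (prj y))\<^sup>2) * (prj y \<bullet> (prj y - \<theta>)) / \<sigma>\<^sup>2) * f y) 0"
proof -
  let ?h = "\<lambda>y. H y ((norm (prj y))\<^sup>2)" and ?h1 = "\<lambda>y. H1 y ((norm (prj y))\<^sup>2)"
  let ?G = "\<lambda>i y. (?h y + 2 * (prj y $ i)\<^sup>2 / (norm (prj y))\<^sup>2 * ?h1 y
      - ?h y * (prj y $ i * (prj y $ i - \<theta> $ i)) / \<sigma>\<^sup>2) * f y"
  let ?S = "\<lambda>y. (CARD('m) * ?h y + 2 * ?h1 y - ?h y * (prj y \<bullet> (prj y - \<theta>)) / \<sigma>\<^sup>2) * f y"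
  note [measurable] = meas borel_measurable_integrable[OF int(1)]
  have "has_bochner_integral lborel (?G i) 0" for i
    using stein_coordinate[OF prj_line inv meas der B f \<sigma> int(1) int(2)[of i]]
    by (simp add: has_bochner_integral_iff)
  then have "has_bochner_integral lborel (\<lambda>y. \<Sum>i\<in>UNIV. ?G i y) (\<Sum>i\<in>(UNIV::'m set). 0)"
    by (intro has_bochner_integral_sum)
  moreover have "AE y in lborel. (\<Sum>i\<in>UNIV. ?G i y) = ?S y"
    using nz
  proof eventually_elim
    case (elim y)
    have n: "(\<Sum>i\<in>UNIV. (prj y $ i)\<^sup>2) = (norm (prj y))\<^sup>2"
      unfolding power2_norm_eq_inner inner_vec_def by (simp add: power2_eq_square)
    have "(\<Sum>i\<in>UNIV. ?G i y) = (CARD('m) * ?h y + 2 * (\<Sum>i\<in>UNIV. (prj y $ i)\<^sup>2) / (norm (prj y))\<^sup>2 * ?h1 y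
        - ?h y * (\<Sum>i\<in>UNIV. prj y $ i * (prj y $ i - \<theta> $ i)) / \<sigma>\<^sup>2) * f y"
      by (simp add: sum_distrib_right[symmetric] sum_distrib_left[symmetric] sum_divide_distrib[symmetric]
          sum.distrib sum_subtractf)
    also have "\<dots> = ?S y"
      unfolding n using elim by (simp add: inner_vec_def)
    finally show ?case .
  qed
  ultimately show ?thesis
    by (subst (asm) has_bochner_integral_cong_AE) (auto simp: measurable_lborel1)
qed

section \<open>Gaussian integrals and the risk\<close>

lemma nn_integral_cart_prod:
  fixes F :: "'m::finite \<Rightarrow> real \<Rightarrow> ennreal"
  assumes [measurable]: "\<And>i. F i \<in> borel_measurable borel"
  shows "(\<integral>\<^sup>+x. (\<Prod>i\<in>UNIV. F i ((x::real^'m) $ i)) \<partial>lborel) = (\<Prod>i\<in>UNIV. \<integral>\<^sup>+t. F i t \<partial>lborel)"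
proof -
  let ?e = "\<lambda>i::'m. axis i (1::real)"
  have inj: "inj ?e" by (auto simp: inj_def axis_eq_axis)
  have Basis: "(Basis :: (real^'m) set) = range ?e" by (auto simp: Basis_vec_def)
  have "(\<integral>\<^sup>+x. (\<Prod>b\<in>Basis. F (inv ?e b) ((x::real^'m) \<bullet> b)) \<partial>lborel)
      = (\<Prod>b\<in>(Basis::(real^'m) set). \<integral>\<^sup>+t. F (inv ?e b) t \<partial>lborel)"
    by (rule nn_integral_lborel_prod) auto
  then show ?thesis
    by (simp add: Basis prod.reindex[OF inj] inv_f_f[OF inj] inner_axis)
qed

definition gauss :: "real^'m \<Rightarrow> real \<Rightarrow> real^'m \<Rightarrow> real" where
  "gauss \<mu> \<sigma> x = (\<Prod>i\<in>UNIV. normal_density (\<mu> $ i) \<sigma> (x $ i))"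

lemma gauss_nonneg: "gauss \<mu> \<sigma> x \<ge> 0"
  by (simp add: gauss_def prod_nonneg)

lemma measurable_gauss [measurable]: "gauss \<mu> \<sigma> \<in> borel_measurable borel"
  unfolding gauss_def[abs_def] by measurable

lemma gauss_exp:
  fixes \<mu> x :: "real^'m"
  shows "gauss \<mu> \<sigma> x = (1 / sqrt (2 * pi * \<sigma>\<^sup>2)) ^ CARD('m) * exp (- (norm (x - \<mu>))\<^sup>2 / (2 * \<sigma>\<^sup>2))"
proof -
  have n: "(norm (x - \<mu>))\<^sup>2 = (\<Sum>i\<in>UNIV. (x $ i - \<mu> $ i)\<^sup>2)"
    unfolding power2_norm_eq_inner inner_vec_def by (simp add: power2_eq_square)
  have "gauss \<mu> \<sigma> x = (\<Prod>i\<in>(UNIV::'m set). 1 / sqrt (2 * pi * \<sigma>\<^sup>2)) *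
      (\<Prod>i\<in>UNIV. exp (- (x $ i - \<mu> $ i)\<^sup>2 / (2 * \<sigma>\<^sup>2)))"
    unfolding gauss_def normal_density_def by (rule prod.distrib)
  also have "(\<Prod>i\<in>UNIV. exp (- (x $ i - \<mu> $ i)\<^sup>2 / (2 * \<sigma>\<^sup>2))) = exp (- (norm (x - \<mu>))\<^sup>2 / (2 * \<sigma>\<^sup>2))"
    unfolding n by (simp add: exp_sum[symmetric] sum_negf sum_divide_distrib)
  finally show ?thesis by simp
qed

text \<open>The centre \<open>y\<close> is arbitrary because the Bayes bound needs the distance to
  any decision, not just to the mean.\<close>

lemma normal_second_moment:
  assumes \<sigma>: "\<sigma> > 0"
  shows "(\<integral>\<^sup>+t. ennreal (normal_density \<mu> \<sigma> t * (t - y)\<^sup>2) \<partial>lborel) = ennreal (\<sigma>\<^sup>2 + (\<mu> - y)\<^sup>2)"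
proof -
  have 2: "has_bochner_integral lborel (\<lambda>t. normal_density \<mu> \<sigma> t * (t - \<mu>)\<^sup>2) (\<sigma>\<^sup>2)"
    using normal_moment_even[OF \<sigma>, of \<mu> 1] \<sigma> by (simp add: fact_numeral)
  have 1: "has_bochner_integral lborel (\<lambda>t. normal_density \<mu> \<sigma> t * (t - \<mu>)) 0"
    using normal_moment_odd[OF \<sigma>, of \<mu> 0] by simp
  have 0: "has_bochner_integral lborel (normal_density \<mu> \<sigma>) 1"
    using normal_moment_even[OF \<sigma>, of \<mu> 0] by simp
  have "has_bochner_integral lborel (\<lambda>t. normal_density \<mu> \<sigma> t * (t - \<mu>)\<^sup>2 +
      2 * (\<mu> - y) * (normal_density \<mu> \<sigma> t * (t - \<mu>)) + (\<mu> - y)\<^sup>2 * normal_density \<mu> \<sigma> t)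
      (\<sigma>\<^sup>2 + 2 * (\<mu> - y) * 0 + (\<mu> - y)\<^sup>2 * 1)"
    by (intro has_bochner_integral_add has_bochner_integral_mult_right 0 1 2)
  then have "has_bochner_integral lborel (\<lambda>t. normal_density \<mu> \<sigma> t * (t - y)\<^sup>2) (\<sigma>\<^sup>2 + (\<mu> - y)\<^sup>2)"
    by (simp add: power2_eq_square algebra_simps)
  then show ?thesis
    by (subst nn_integral_eq_integral) (auto simp: has_bochner_integral_iff)
qed

lemma nn_integral_normal_density: "\<sigma> > 0 \<Longrightarrow> (\<integral>\<^sup>+t. ennreal (normal_density \<mu> \<sigma> t) \<partial>lborel) = 1"
  by (subst nn_integral_eq_integral) auto

lemma nn_integral_gauss:
  fixes \<mu> :: "real^'m"
  assumes "\<sigma> > 0"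
  shows "(\<integral>\<^sup>+x. ennreal (gauss \<mu> \<sigma> x) \<partial>lborel) = 1"
  using nn_integral_cart_prod[of "\<lambda>i t. ennreal (normal_density (\<mu> $ i) \<sigma> t)"] assms
  by (simp add: gauss_def prod_ennreal nn_integral_normal_density)

lemma gauss_second_moment:
  fixes \<mu> :: "real^'m"
  assumes \<sigma>: "\<sigma> > 0"
  shows "(\<integral>\<^sup>+x. ennreal (gauss \<mu> \<sigma> x * (x $ i - y)\<^sup>2) \<partial>lborel) = ennreal (\<sigma>\<^sup>2 + (\<mu> $ i - y)\<^sup>2)"
proof -
  let ?F = "\<lambda>j t. normal_density (\<mu> $ j) \<sigma> t * (if j = i then (t - y)\<^sup>2 else 1)"
  have "(\<integral>\<^sup>+x. ennreal (gauss \<mu> \<sigma> x * (x $ i - y)\<^sup>2) \<partial>lborel) = (\<integral>\<^sup>+x. (\<Prod>j\<in>UNIV. ennreal (?F j (x $ j))) \<partial>lborel)"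
    by (simp add: gauss_def prod_ennreal prod.distrib)
  also have "\<dots> = (\<Prod>j\<in>UNIV. \<integral>\<^sup>+t. ennreal (?F j t) \<partial>lborel)"
    by (rule nn_integral_cart_prod) measurable
  also have "\<dots> = (\<Prod>j\<in>UNIV. if j = i then ennreal (\<sigma>\<^sup>2 + (\<mu> $ i - y)\<^sup>2) else 1)"
    by (rule prod.cong) (auto simp: normal_second_moment[OF \<sigma>] nn_integral_normal_density[OF \<sigma>])
  also have "\<dots> = ennreal (\<sigma>\<^sup>2 + (\<mu> $ i - y)\<^sup>2)" by simp
  finally show ?thesis .
qed

lemma nn_integral_lborel_pair_mult:
  fixes F :: "'a::euclidean_space \<Rightarrow> ennreal" and G :: "'b::euclidean_space \<Rightarrow> ennreal"
  assumes [measurable]: "F \<in> borel_measurable borel" "G \<in> borel_measurable borel"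
  shows "(\<integral>\<^sup>+y. F (fst y) * G (snd y) \<partial>lborel) = (\<integral>\<^sup>+x. F x \<partial>lborel) * (\<integral>\<^sup>+z. G z \<partial>lborel)"
proof -
  have "(\<integral>\<^sup>+y. F (fst y) * G (snd y) \<partial>lborel) = (\<integral>\<^sup>+y. F (fst y) * G (snd y) \<partial>(lborel \<Otimes>\<^sub>M lborel))"
    by (simp add: lborel_prod)
  also have "\<dots> = (\<integral>\<^sup>+x. \<integral>\<^sup>+z. F x * G z \<partial>lborel \<partial>lborel)"
    by (subst lborel.nn_integral_fst[symmetric]) auto
  also have "\<dots> = (\<integral>\<^sup>+x. F x \<partial>lborel) * (\<integral>\<^sup>+z. G z \<partial>lborel)"
    by (simp add: nn_integral_cmult nn_integral_multc)
  finally show ?thesis .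
qed

definition joint :: "real^'p \<Rightarrow> real \<Rightarrow> (real^'p) \<times> (real^'n) \<Rightarrow> real" where
  "joint \<theta> \<sigma> y = gauss \<theta> \<sigma> (fst y) * gauss 0 \<sigma> (snd y)"

lemma joint_nonneg: "joint \<theta> \<sigma> y \<ge> 0"
  by (simp add: joint_def gauss_nonneg)

lemma measurable_joint [measurable]:
  "(joint \<theta> \<sigma> :: (real^'p) \<times> (real^'n) \<Rightarrow> real) \<in> borel_measurable borel"
  unfolding joint_def[abs_def] borel_prod[symmetric] by measurable

lemma risk_eq:
  fixes d :: "(real^'p) \<times> (real^'n) \<Rightarrow> real^'p"
  assumes [measurable]: "d \<in> borel_measurable borel"
  shows "risk d \<theta> \<sigma> = (\<integral>\<^sup>+y. ennreal (joint \<theta> \<sigma> y) * ennreal ((norm (d y - \<theta>))\<^sup>2 / \<sigma>\<^sup>2) \<partial>lborel)"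
proof -
  have "model \<theta> \<sigma> = density lborel (\<lambda>y::(real^'p) \<times> (real^'n). ennreal (joint \<theta> \<sigma> y))"
    by (simp add: model_def joint_def gauss_def case_prod_unfold)
  then show ?thesis unfolding risk_def by (simp add: nn_integral_density)
qed

lemma joint_integrals:
  fixes \<theta> :: "real^'p"
  assumes \<sigma>: "\<sigma> > 0"
  defines "f \<equiv> joint \<theta> \<sigma> :: (real^'p) \<times> (real^'n) \<Rightarrow> real"
  shows "has_bochner_integral lborel f 1"
    and "has_bochner_integral lborel (\<lambda>y. (fst y $ i - \<theta> $ i)\<^sup>2 * f y) (\<sigma>\<^sup>2)"
    and "has_bochner_integral lborel (\<lambda>y. (snd y $ j - (0::real^'n) $ j)\<^sup>2 * f y) (\<sigma>\<^sup>2)"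
proof -
  have [measurable]: "f \<in> borel_measurable borel" by (simp add: f_def)
  have "(\<integral>\<^sup>+y. ennreal (f y) \<partial>lborel) = 1"
    using nn_integral_lborel_pair_mult[of "\<lambda>x. ennreal (gauss \<theta> \<sigma> x)" "\<lambda>z::real^'n. ennreal (gauss 0 \<sigma> z)"]
    by (simp add: f_def joint_def nn_integral_gauss[OF \<sigma>] ennreal_mult gauss_nonneg)
  then show "has_bochner_integral lborel f 1"
    by (intro has_bochner_integral_nn_integral) (auto simp: f_def joint_nonneg)
  have "(\<integral>\<^sup>+y. ennreal ((fst y $ i - \<theta> $ i)\<^sup>2 * f y) \<partial>lborel) = ennreal (\<sigma>\<^sup>2)"
    using nn_integral_lborel_pair_mult[of "\<lambda>x. ennreal (gauss \<theta> \<sigma> x * (x $ i - \<theta> $ i)\<^sup>2)" "\<lambda>z::real^'n. ennreal (gauss 0 \<sigma> z)"]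
    by (simp add: f_def joint_def nn_integral_gauss[OF \<sigma>] gauss_second_moment[OF \<sigma>] ennreal_mult[symmetric]
        gauss_nonneg mult_ac)
  then show "has_bochner_integral lborel (\<lambda>y. (fst y $ i - \<theta> $ i)\<^sup>2 * f y) (\<sigma>\<^sup>2)"
    by (intro has_bochner_integral_nn_integral) (auto simp: f_def joint_nonneg)
  have "(\<integral>\<^sup>+y. ennreal ((snd y $ j - (0::real^'n) $ j)\<^sup>2 * f y) \<partial>lborel) = ennreal (\<sigma>\<^sup>2)"
    using nn_integral_lborel_pair_mult[of "\<lambda>x. ennreal (gauss \<theta> \<sigma> x)" "\<lambda>z::real^'n. ennreal (gauss 0 \<sigma> z * (z $ j - (0::real^'n) $ j)\<^sup>2)"]
    by (simp add: f_def joint_def nn_integral_gauss[OF \<sigma>] gauss_second_moment[OF \<sigma>, of 0 j 0, simplified]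
        ennreal_mult[symmetric] gauss_nonneg mult_ac)
  then show "has_bochner_integral lborel (\<lambda>y. (snd y $ j - (0::real^'n) $ j)\<^sup>2 * f y) (\<sigma>\<^sup>2)"
    by (intro has_bochner_integral_nn_integral) (auto simp: f_def joint_nonneg)
qed

lemma AE_fst_snd_nonzero:
  "AE y in lborel. fst y \<noteq> (0::real^'p) \<and> snd y \<noteq> (0::real^'n)"
proof -
  fix i :: 'p and j :: 'n
  have "(axis i 1, 0) \<in> (Basis :: ((real^'p) \<times> (real^'n)) set)" "(0, axis j 1) \<in> (Basis :: ((real^'p) \<times> (real^'n)) set)"
    by (auto simp: Basis_prod_def Basis_vec_def)
  from this[THEN AE_lborel_inner_neq[where c = 0]] show ?thesis
    by eventually_elim auto
qed

text \<open>Write d = X - h X. Stein's identity in X removes the cross term h X . (X - \<theta>);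
  since h^2 |X|^2 = k |Z|^2, the identity in Z removes the quadratic term. The loss is then at most
  that of X plus terms of mean zero, provided 2 p h + 4 h1 - n k + 2 k1 >= 0, and \<open>w\<close>
  times this expression is the left side of \<open>ineq\<close>.\<close>

lemma risk_le_of_differential_inequality:
  fixes \<phi> \<phi>' :: "real \<Rightarrow> real" and d :: "(real^'p) \<times> (real^'n) \<Rightarrow> real^'p"
  assumes \<sigma>: "\<sigma> > 0" and d[measurable]: "d \<in> borel_measurable borel"
    and d_eq: "\<And>x z. x \<noteq> 0 \<Longrightarrow> z \<noteq> 0 \<Longrightarrow>
      d (x, z) = (1 - \<phi> ((norm x)\<^sup>2 / (norm z)\<^sup>2) / ((norm x)\<^sup>2 / (norm z)\<^sup>2)) *\<^sub>R x"
    and der: "\<And>w. w > 0 \<Longrightarrow> (\<phi> has_real_derivative \<phi>' w) (at w)"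
    and pos: "\<And>w. w > 0 \<Longrightarrow> 0 < \<phi> w" and less: "\<And>w. w > 0 \<Longrightarrow> \<phi> w < w"
    and B: "\<And>w. w > 0 \<Longrightarrow> \<phi> w \<le> B" "\<And>w. w > 0 \<Longrightarrow> \<bar>\<phi>' w\<bar> \<le> B"
    and meas': "(\<lambda>w. if w > 0 then \<phi>' w else 0) \<in> borel_measurable borel"
    and ineq: "\<And>w. w > 0 \<Longrightarrow>
      2 * (real CARD('p) - 2) * \<phi> w - (real CARD('n) + 2) * (\<phi> w)\<^sup>2 + 4 * (1 + \<phi> w) * (w * \<phi>' w) \<ge> 0"
  shows "risk d \<theta> \<sigma> \<le> ennreal (real CARD('p))"
proof -
  define p n where "p = real CARD('p)" "n = real CARD('n)"
  note pn = this
  \<comment> \<open>\<open>h\<close> = \<phi>/w and \<open>k\<close> = \<phi>^2/w, while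
    \<open>h1\<close> and \<open>k1\<close> are w h' and w k'. All four are bounded and set to 0 off
    the positive axis.\<close>
  define h where "h w = (if w > 0 then \<phi> w / w else 0)" for w
  define h1 where "h1 w = (if w > 0 then \<phi>' w - \<phi> w / w else 0)" for w
  define k where "k w = (if w > 0 then (\<phi> w)\<^sup>2 / w else 0)" for w
  define k1 where "k1 w = (if w > 0 then 2 * \<phi> w * \<phi>' w - (\<phi> w)\<^sup>2 / w else 0)" for w
  define C where "C = 2 * B * B + B + 1"
  have B0: "B \<ge> 0" using B(1)[of 1] pos[of 1] by simp
  have [measurable]: "(\<lambda>w. if w > 0 then \<phi> w else 0) \<in> borel_measurable borel"
    using der DERIV_isCont by (intro measurable_if_positive) blast
  note meas'[measurable]
  have h_alt: "h = (\<lambda>w. (if w > 0 then \<phi> w else 0) / w)" by (auto simp: h_def)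
  have h1_alt: "h1 = (\<lambda>w. (if w > 0 then \<phi>' w else 0) - (if w > 0 then \<phi> w else 0) / w)" by (auto simp: h1_def)
  have k_alt: "k = (\<lambda>w. (if w > 0 then \<phi> w else 0)\<^sup>2 / w)" by (auto simp: k_def)
  have k1_alt: "k1 = (\<lambda>w. 2 * (if w > 0 then \<phi> w else 0) * (if w > 0 then \<phi>' w else 0) - (if w > 0 then \<phi> w else 0)\<^sup>2 / w)"
    by (auto simp: k1_def)
  have [measurable]: "h \<in> borel_measurable borel" "h1 \<in> borel_measurable borel"
    "k \<in> borel_measurable borel" "k1 \<in> borel_measurable borel"
    unfolding h_alt h1_alt k_alt k1_alt by measurable
  have hder: "(h has_real_derivative h1 w / w) (at w)" if w: "w > 0" for w
  proof (rule DERIV_cong_ev[THEN iffD1, OF refl _ refl])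
    show "\<forall>\<^sub>F u in nhds w. \<phi> u / u = h u"
      using w order_tendstoD(1)[of "\<lambda>x. x" w "nhds w" 0]
      by (auto simp: h_def tendsto_def filterlim_ident elim!: eventually_mono)
    show "((\<lambda>u. \<phi> u / u) has_real_derivative h1 w / w) (at w)"
      using w by (auto intro!: derivative_eq_intros der simp: h1_def field_simps)
  qed
  have kder: "(k has_real_derivative k1 w / w) (at w)" if w: "w > 0" for w
  proof (rule DERIV_cong_ev[THEN iffD1, OF refl _ refl])
    show "\<forall>\<^sub>F u in nhds w. (\<phi> u)\<^sup>2 / u = k u"
      using w order_tendstoD(1)[of "\<lambda>x. x" w "nhds w" 0]
      by (auto simp: k_def tendsto_def filterlim_ident elim!: eventually_mono)
    show "((\<lambda>u. (\<phi> u)\<^sup>2 / u) has_real_derivative k1 w / w) (at w)"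
      using w by (auto intro!: derivative_eq_intros der simp: k1_def field_simps power2_eq_square)
  qed
  have hle: "\<phi> w / w \<le> 1" "\<phi> w / w \<ge> 0" if "w > 0" for w
    using less[OF that] pos[OF that] that by (auto simp: divide_le_eq_1)
  have kle: "(\<phi> w)\<^sup>2 / w \<le> B" "(\<phi> w)\<^sup>2 / w \<ge> 0" if "w > 0" for w
  proof -
    have "\<phi> w * (\<phi> w / w) \<le> B * 1" using that hle[OF that] B(1)[OF that] pos[OF that] B0 by (intro mult_mono) auto
    then show "(\<phi> w)\<^sup>2 / w \<le> B" by (simp add: power2_eq_square)
  qed (use that in auto)
  have Bh: "\<bar>h w\<bar> \<le> C" "\<bar>h1 w\<bar> \<le> C" "\<bar>k w\<bar> \<le> C" "\<bar>- k1 w\<bar> \<le> C" for w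
  proof -
    have BB: "B * B \<ge> 0" using B0 by simp
    then have C: "C \<ge> 1" "C \<ge> B + 1" using B0 by (auto simp: C_def)
    have "\<bar>\<phi> w / w\<bar> \<le> C" if "w > 0" using hle[OF that] C by linarith
    then show "\<bar>h w\<bar> \<le> C" using C by (simp add: h_def)
    have "\<bar>\<phi>' w - \<phi> w / w\<bar> \<le> C" if "w > 0" using hle[OF that] B(2)[OF that] C by linarith
    then show "\<bar>h1 w\<bar> \<le> C" using C by (simp add: h1_def)
    have "\<bar>(\<phi> w)\<^sup>2 / w\<bar> \<le> C" if "w > 0" using kle[OF that] C by linarith
    then show "\<bar>k w\<bar> \<le> C" using C by (simp add: k_def)
    show "\<bar>- k1 w\<bar> \<le> C"
    proof (cases "w > 0")
      case True
      have "\<phi> w * \<bar>\<phi>' w\<bar> \<le> B * B" using True B[of w] pos[of w] B0 by (intro mult_mono) auto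
      then have "\<bar>2 * \<phi> w * \<phi>' w\<bar> \<le> 2 * B * B" using pos[OF True] by (simp add: abs_mult)
      then have "\<bar>2 * \<phi> w * \<phi>' w - (\<phi> w)\<^sup>2 / w\<bar> \<le> C" unfolding C_def using kle[OF True] B0 by linarith
      then show ?thesis using True by (simp add: k1_def abs_minus_commute)
    qed (use B0 BB in \<open>auto simp: k1_def C_def\<close>)
  qed
  let ?f = "joint \<theta> \<sigma> :: (real^'p) \<times> (real^'n) \<Rightarrow> real"
  let ?W = "\<lambda>y::(real^'p) \<times> (real^'n). (norm (fst y))\<^sup>2 / (norm (snd y))\<^sup>2"
  note ji = joint_integrals[where 'n = 'n and \<theta> = \<theta>, OF \<sigma>]
  note jint = ji[THEN integrable.intros]
  have Wm[measurable]: "?W \<in> borel_measurable borel" by measurable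
  have SX: "has_bochner_integral lborel (\<lambda>y. (CARD('p) * h (?W y) + 2 * h1 (?W y)
      - h (?W y) * (fst y \<bullet> (fst y - \<theta>)) / \<sigma>\<^sup>2) * ?f y) 0"
  proof (rule stein_identity[where prj = fst and v = "\<lambda>i. (axis i 1, 0)" and B = C
        and H = "\<lambda>y r. h (r / (norm (snd y))\<^sup>2)" and ?H1.0 = "\<lambda>y r. h1 (r / (norm (snd y))\<^sup>2)"
        and g = "\<lambda>y. (1 / sqrt (2 * pi * \<sigma>\<^sup>2)) ^ CARD('p) * gauss 0 \<sigma> (snd y)"])
    show "AE y in lborel. \<forall>r>0. ((\<lambda>r. h (r / (norm (snd (y :: (real^'p) \<times> (real^'n))))\<^sup>2)) has_real_derivative
        h1 (r / (norm (snd y))\<^sup>2) / r) (at r)"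
      using AE_fst_snd_nonzero
    proof eventually_elim
      case (elim y)
      define S where "S = (norm (snd y))\<^sup>2"
      have S: "S > 0" using elim by (simp add: S_def)
      have "((\<lambda>r. h (r / S)) has_real_derivative h1 (r / S) / (r / S) * (1 / S)) (at r)" if "r > 0" for r
        by (rule DERIV_chain2[OF hder]) (use that S in \<open>auto intro!: derivative_eq_intros\<close>)
      then show ?case using S by (simp add: S_def)
    qed
    show "AE y in lborel. fst (y :: (real^'p) \<times> (real^'n)) \<noteq> 0"
      using AE_fst_snd_nonzero by eventually_elim auto
    show "?f y = exp (- (norm (fst y - \<theta>))\<^sup>2 / (2 * \<sigma>\<^sup>2)) * ((1 / sqrt (2 * pi * \<sigma>\<^sup>2)) ^ CARD('p) * gauss 0 \<sigma> (snd y))" for y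
      by (simp add: joint_def gauss_exp[of \<theta>])
  qed (use jint Bh \<sigma> in \<open>auto simp: joint_nonneg\<close>)
  \<comment> \<open>Here the variable is |Z|^2 in the denominator of W, so its scaled derivative is
    minus \<open>k1\<close>.\<close>
  have SZ: "has_bochner_integral lborel (\<lambda>y. (CARD('n) * k (?W y) + 2 * (- k1 (?W y))
      - k (?W y) * (snd y \<bullet> (snd y - 0)) / \<sigma>\<^sup>2) * ?f y) 0"
  proof (rule stein_identity[where prj = snd and v = "\<lambda>i. (0, axis i 1)" and B = C and \<theta> = 0
        and H = "\<lambda>y r. k ((norm (fst y))\<^sup>2 / r)" and ?H1.0 = "\<lambda>y r. - k1 ((norm (fst y))\<^sup>2 / r)"
        and g = "\<lambda>y. (1 / sqrt (2 * pi * \<sigma>\<^sup>2)) ^ CARD('n) * gauss \<theta> \<sigma> (fst y)"])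
    show "AE y in lborel. \<forall>r>0. ((\<lambda>r. k ((norm (fst (y :: (real^'p) \<times> (real^'n))))\<^sup>2 / r)) has_real_derivative
        - k1 ((norm (fst y))\<^sup>2 / r) / r) (at r)"
      using AE_fst_snd_nonzero
    proof eventually_elim
      case (elim y)
      define S where "S = (norm (fst y))\<^sup>2"
      have S: "S > 0" using elim by (simp add: S_def)
      have "((\<lambda>r. k (S / r)) has_real_derivative k1 (S / r) / (S / r) * (- S / (r * r))) (at r)" if "r > 0" for r
        by (rule DERIV_chain2[OF kder]) (use that S in \<open>auto intro!: derivative_eq_intros\<close>)
      then show ?case using S by (simp add: S_def field_simps)
    qed
    show "AE y in lborel. snd (y :: (real^'p) \<times> (real^'n)) \<noteq> 0"
      using AE_fst_snd_nonzero by eventually_elim auto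
    show "?f y = exp (- (norm (snd y - 0))\<^sup>2 / (2 * \<sigma>\<^sup>2)) * ((1 / sqrt (2 * pi * \<sigma>\<^sup>2)) ^ CARD('n) * gauss \<theta> \<sigma> (fst y))" for y
      by (simp add: joint_def gauss_exp[of 0])
  qed (use jint Bh \<sigma> in \<open>auto simp: joint_nonneg\<close>)
  have Q: "has_bochner_integral lborel (\<lambda>y. (norm (fst y - \<theta>))\<^sup>2 / \<sigma>\<^sup>2 * ?f y) p"
  proof -
    have "has_bochner_integral lborel (\<lambda>y. (\<Sum>i\<in>UNIV. (fst y $ i - \<theta> $ i)\<^sup>2 * ?f y) / \<sigma>\<^sup>2) ((\<Sum>i\<in>(UNIV::'p set). \<sigma>\<^sup>2) / \<sigma>\<^sup>2)"
      by (intro has_bochner_integral_divide has_bochner_integral_sum ji)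
    moreover have "(\<Sum>i\<in>UNIV. (fst y $ i - \<theta> $ i)\<^sup>2 * ?f y) / \<sigma>\<^sup>2 = (norm (fst y - \<theta>))\<^sup>2 / \<sigma>\<^sup>2 * ?f y" for y
      unfolding power2_norm_eq_inner inner_vec_def by (simp add: power2_eq_square sum_distrib_right[symmetric])
    ultimately show ?thesis using \<sigma> by (simp add: pn)
  qed
  \<comment> \<open>The loss of X plus twice the first Stein term minus the second one: its integral
    is \<open>p\<close>, and it dominates the loss of \<open>d\<close>.\<close>
  define R where "R y = (norm (fst y - \<theta>))\<^sup>2 / \<sigma>\<^sup>2 * ?f y +
      2 * ((CARD('p) * h (?W y) + 2 * h1 (?W y) - h (?W y) * (fst y \<bullet> (fst y - \<theta>)) / \<sigma>\<^sup>2) * ?f y) -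
      (CARD('n) * k (?W y) + 2 * (- k1 (?W y)) - k (?W y) * (snd y \<bullet> (snd y - 0)) / \<sigma>\<^sup>2) * ?f y" for y
  have R: "has_bochner_integral lborel R (p + 2 * 0 - 0)"
    unfolding R_def[abs_def] by (intro has_bochner_integral_add has_bochner_integral_diff has_bochner_integral_mult_right Q SX SZ)
  have bound: "AE y in lborel. ?f y * ((norm (d y - \<theta>))\<^sup>2 / \<sigma>\<^sup>2) \<le> R y"
    using AE_fst_snd_nonzero
  proof eventually_elim
    case (elim y)
    obtain x z where y: "y = (x, z)" by (cases y)
    have xz: "x \<noteq> 0" "z \<noteq> 0" using elim by (auto simp: y)
    define w where "w = (norm x)\<^sup>2 / (norm z)\<^sup>2"
    have w: "w > 0" using xz by (simp add: w_def)
    have dx: "d y - \<theta> = (x - \<theta>) - h w *\<^sub>R x"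
      using d_eq[OF xz] w by (simp add: y h_def w_def[symmetric] algebra_simps)
    have n: "(norm (d y - \<theta>))\<^sup>2 = (norm (x - \<theta>))\<^sup>2 - 2 * h w * (x \<bullet> (x - \<theta>)) + (h w)\<^sup>2 * (norm x)\<^sup>2"
      unfolding dx power2_norm_eq_inner
      by (simp add: inner_diff_left inner_diff_right inner_commute power2_eq_square algebra_simps)
    have hk: "(h w)\<^sup>2 * (norm x)\<^sup>2 = k w * (norm z)\<^sup>2"
    proof -
      have "(norm x)\<^sup>2 = w * (norm z)\<^sup>2" using xz by (simp add: w_def)
      then show ?thesis using w by (simp add: h_def k_def power2_eq_square)
    qed
    have "w * (2 * p * h w + 4 * h1 w - n * k w + 2 * k1 w) =
       2 * (p - 2) * \<phi> w - (n + 2) * (\<phi> w)\<^sup>2 + 4 * (1 + \<phi> w) * (w * \<phi>' w)"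
      using w by (simp add: h_def h1_def k_def k1_def field_simps power2_eq_square)
    also have "\<dots> \<ge> 0" using ineq[OF w] by (simp add: pn)
    finally have nonneg: "2 * p * h w + 4 * h1 w - n * k w + 2 * k1 w \<ge> 0"
      using w by (simp add: zero_le_mult_iff)
    have "R y - ?f y * ((norm (d y - \<theta>))\<^sup>2 / \<sigma>\<^sup>2) = (2 * p * h w + 4 * h1 w - n * k w + 2 * k1 w) * ?f y"
    proof -
      have zz: "z \<bullet> (z - 0) = (norm z)\<^sup>2" by (simp add: power2_norm_eq_inner)
      show ?thesis
        unfolding R_def n hk unfolding y fst_conv snd_conv zz w_def[symmetric] pn
        by (simp add: algebra_simps add_divide_distrib diff_divide_distrib)
    qed
    also have "\<dots> \<ge> 0" using nonneg joint_nonneg by (rule mult_nonneg_nonneg)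
    finally show ?case by simp
  qed
  have nn: "AE y in lborel. 0 \<le> R y"
    using bound by eventually_elim (rule order_trans[rotated], auto simp: joint_nonneg)
  have "risk d \<theta> \<sigma> = (\<integral>\<^sup>+y. ennreal (?f y * ((norm (d y - \<theta>))\<^sup>2 / \<sigma>\<^sup>2)) \<partial>lborel)"
    unfolding risk_eq[OF d] by (intro nn_integral_cong) (simp add: ennreal_mult[symmetric] joint_nonneg)
  also have "\<dots> \<le> (\<integral>\<^sup>+y. ennreal (R y) \<partial>lborel)"
    using bound by (intro nn_integral_mono_AE) (auto elim!: eventually_mono intro: ennreal_leI)
  also have "\<dots> = ennreal p"
    using R nn by (subst nn_integral_eq_integral) (auto simp: has_bochner_integral_iff)
  finally show ?thesis by (simp add: pn)
qed

section \<open>The minimax value\<close>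

text \<open>Completing the square: prior times likelihood is marginal, with variance 1 + \<tau>^2,
  times posterior, with variance \<tau>^2/(1 + \<tau>^2).\<close>

lemma normal_density_bayes:
  fixes \<tau> t x :: real
  assumes \<tau>: "\<tau> > 0"
  shows "normal_density 0 \<tau> t * normal_density t 1 x =
    normal_density 0 (sqrt (1 + \<tau>\<^sup>2)) x * normal_density (\<tau>\<^sup>2 / (1 + \<tau>\<^sup>2) * x) (\<tau> / sqrt (1 + \<tau>\<^sup>2)) t"
proof -
  define T where "T = \<tau>\<^sup>2"
  have T: "T > 0" using \<tau> by (simp add: T_def)
  have s: "(sqrt (1 + T))\<^sup>2 = 1 + T" "(\<tau> / sqrt (1 + T))\<^sup>2 = T / (1 + T)"
    using T by (auto simp: T_def power_divide)
  have c: "1 / sqrt (2 * pi * T) * (1 / sqrt (2 * pi * 1)) = 1 / sqrt (2 * pi * (1 + T)) * (1 / sqrt (2 * pi * (T / (1 + T))))"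
  proof -
    have "2 * pi * T * (2 * pi * 1) = 2 * pi * (1 + T) * (2 * pi * (T / (1 + T)))" using T by (simp add: field_simps)
    then show ?thesis by (simp only: real_sqrt_mult[symmetric] times_divide_times_eq mult_1_left)
  qed
  have e: "- (t - 0)\<^sup>2 / (2 * T) + - (x - t)\<^sup>2 / (2 * 1) =
      - (x - 0)\<^sup>2 / (2 * (1 + T)) + - (t - T / (1 + T) * x)\<^sup>2 / (2 * (T / (1 + T)))"
  proof -
    have "(t - T / (1 + T) * x)\<^sup>2 / (2 * (T / (1 + T))) = ((1 + T) * t - T * x)\<^sup>2 / (2 * T * (1 + T))"
    proof -
      have "t - T / (1 + T) * x = ((1 + T) * t - T * x) / (1 + T)" using T by (simp add: field_simps)
      then show ?thesis using T by (simp add: power_divide power2_eq_square)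
    qed
    moreover have "(t - 0)\<^sup>2 / (2 * T) + (x - t)\<^sup>2 / (2 * 1) = (x - 0)\<^sup>2 / (2 * (1 + T)) + ((1 + T) * t - T * x)\<^sup>2 / (2 * T * (1 + T))"
      using T by (simp add: divide_simps) (simp add: power2_eq_square algebra_simps)
    ultimately show ?thesis by simp
  qed
  have "normal_density 0 \<tau> t * normal_density t 1 x =
      (1 / sqrt (2 * pi * T) * (1 / sqrt (2 * pi * 1))) * exp (- (t - 0)\<^sup>2 / (2 * T) + - (x - t)\<^sup>2 / (2 * 1))"
    unfolding normal_density_def exp_add T_def by (simp del: real_sqrt_mult)
  also have "\<dots> = normal_density 0 (sqrt (1 + \<tau>\<^sup>2)) x * normal_density (\<tau>\<^sup>2 / (1 + \<tau>\<^sup>2) * x) (\<tau> / sqrt (1 + \<tau>\<^sup>2)) t"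
    unfolding c e exp_add normal_density_def s T_def[symmetric] by (simp del: real_sqrt_mult)
  finally show ?thesis .
qed

lemma gauss_bayes:
  assumes "\<tau> > 0"
  shows "gauss 0 \<tau> \<theta> * gauss \<theta> 1 x =
    gauss 0 (sqrt (1 + \<tau>\<^sup>2)) x * gauss ((\<tau>\<^sup>2 / (1 + \<tau>\<^sup>2)) *\<^sub>R x) (\<tau> / sqrt (1 + \<tau>\<^sup>2)) \<theta>"
  unfolding gauss_def prod.distrib[symmetric] by (simp add: normal_density_bayes[OF assms])

text \<open>Variance plus squared bias in each coordinate, with the bias dropped: no decision
  \<open>c\<close> beats the posterior variance.\<close>

lemma gauss_sq_distance:
  fixes \<mu> c :: "real^'m"
  assumes \<sigma>: "\<sigma> > 0"
  shows "(\<integral>\<^sup>+x. ennreal (gauss \<mu> \<sigma> x) * ennreal ((norm (c - x))\<^sup>2) \<partial>lborel) \<ge> ennreal (real CARD('m) * \<sigma>\<^sup>2)"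
proof -
  have n: "(norm (c - x))\<^sup>2 = (\<Sum>i\<in>UNIV. (x $ i - c $ i)\<^sup>2)" for x
    unfolding norm_minus_commute[of c] power2_norm_eq_inner inner_vec_def by (simp add: power2_eq_square)
  have "(\<integral>\<^sup>+x. ennreal (gauss \<mu> \<sigma> x) * ennreal ((norm (c - x))\<^sup>2) \<partial>lborel) =
      (\<integral>\<^sup>+x. (\<Sum>i\<in>UNIV. ennreal (gauss \<mu> \<sigma> x * (x $ i - c $ i)\<^sup>2)) \<partial>lborel)"
    unfolding n by (simp add: ennreal_mult[symmetric] gauss_nonneg sum_nonneg sum_distrib_left sum_ennreal)
  also have "\<dots> = (\<Sum>i\<in>UNIV. \<integral>\<^sup>+x. ennreal (gauss \<mu> \<sigma> x * (x $ i - c $ i)\<^sup>2) \<partial>lborel)"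
    by (rule nn_integral_sum) measurable
  also have "\<dots> = (\<Sum>i\<in>UNIV. ennreal (\<sigma>\<^sup>2 + (\<mu> $ i - c $ i)\<^sup>2))"
    by (simp add: gauss_second_moment[OF \<sigma>])
  also have "\<dots> \<ge> (\<Sum>i\<in>(UNIV::'m set). ennreal (\<sigma>\<^sup>2))"
    by (intro sum_mono ennreal_leI) auto
  finally show ?thesis by (simp add: sum_ennreal ennreal_of_nat_eq_real_of_nat ennreal_mult)
qed

text \<open>The maximum dominates the average over a normal prior on \<theta> at \<sigma> = 1.
  Exchanging the order of integration puts the posterior inside, for each fixed observation.
  Nonnegative integrals cover estimators of infinite risk.\<close>

lemma bayes_risk_le_max_risk:
  fixes d :: "(real^'p) \<times> (real^'n) \<Rightarrow> real^'p"
  assumes d[measurable]: "d \<in> borel_measurable borel" and \<tau>: "\<tau> > 0"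
  shows "ennreal (real CARD('p) * (\<tau>\<^sup>2 / (1 + \<tau>\<^sup>2))) \<le> max_risk d"
proof -
  define \<rho> where "\<rho> = sqrt (1 + \<tau>\<^sup>2)"
  have \<rho>: "\<rho> > 0" by (simp add: \<rho>_def add_pos_nonneg)
  have s: "(\<tau> / \<rho>)\<^sup>2 = \<tau>\<^sup>2 / (1 + \<tau>\<^sup>2)" by (simp add: \<rho>_def power_divide)
  let ?L = "\<lambda>\<theta> y. ennreal (gauss 0 \<tau> \<theta>) * (ennreal (joint \<theta> 1 (y :: (real^'p) \<times> (real^'n))) * ennreal ((norm (d y - \<theta>))\<^sup>2))"
  have meas: "(\<lambda>(\<theta>, y). ?L \<theta> y) \<in> borel_measurable (lborel \<Otimes>\<^sub>M lborel)"
    unfolding joint_def gauss_exp by measurable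
  have post: "(\<integral>\<^sup>+\<theta>. ?L \<theta> y \<partial>lborel) \<ge>
      ennreal (gauss 0 \<rho> (fst y)) * ennreal (gauss 0 1 (snd y)) * ennreal (real CARD('p) * (\<tau>\<^sup>2 / (1 + \<tau>\<^sup>2)))" for y
  proof -
    let ?m = "(\<tau>\<^sup>2 / (1 + \<tau>\<^sup>2)) *\<^sub>R fst y"
    have "(\<integral>\<^sup>+\<theta>. ?L \<theta> y \<partial>lborel) = (\<integral>\<^sup>+\<theta>. (ennreal (gauss 0 \<rho> (fst y)) * ennreal (gauss 0 1 (snd y))) *
        (ennreal (gauss ?m (\<tau> / \<rho>) \<theta>) * ennreal ((norm (d y - \<theta>))\<^sup>2)) \<partial>lborel)"
    proof (rule nn_integral_cong)
      fix \<theta>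
      have "gauss 0 \<tau> \<theta> * joint \<theta> 1 y = gauss 0 \<rho> (fst y) * gauss 0 1 (snd y) * gauss ?m (\<tau> / \<rho>) \<theta>"
        using gauss_bayes[OF \<tau>, of \<theta> "fst y"] by (simp add: joint_def \<rho>_def mult_ac)
      then have "ennreal (gauss 0 \<tau> \<theta>) * ennreal (joint \<theta> 1 y) =
          ennreal (gauss 0 \<rho> (fst y)) * ennreal (gauss 0 1 (snd y)) * ennreal (gauss ?m (\<tau> / \<rho>) \<theta>)"
        by (simp add: ennreal_mult[symmetric] gauss_nonneg joint_nonneg)
      then show "?L \<theta> y = (ennreal (gauss 0 \<rho> (fst y)) * ennreal (gauss 0 1 (snd y))) *
        (ennreal (gauss ?m (\<tau> / \<rho>) \<theta>) * ennreal ((norm (d y - \<theta>))\<^sup>2))"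
        by (simp add: mult.assoc[symmetric])
    qed
    also have "\<dots> = (ennreal (gauss 0 \<rho> (fst y)) * ennreal (gauss 0 1 (snd y))) *
        (\<integral>\<^sup>+\<theta>. ennreal (gauss ?m (\<tau> / \<rho>) \<theta>) * ennreal ((norm (d y - \<theta>))\<^sup>2) \<partial>lborel)"
      by (rule nn_integral_cmult) measurable
    also have "\<dots> \<ge> (ennreal (gauss 0 \<rho> (fst y)) * ennreal (gauss 0 1 (snd y))) * ennreal (real CARD('p) * (\<tau> / \<rho>)\<^sup>2)"
      using \<tau> \<rho> by (intro mult_left_mono gauss_sq_distance) auto
    finally show ?thesis unfolding s .
  qed
  have "ennreal (real CARD('p) * (\<tau>\<^sup>2 / (1 + \<tau>\<^sup>2))) = 
     (\<integral>\<^sup>+y. ennreal (gauss (0::real^'p) \<rho> (fst y)) * ennreal (gauss (0::real^'n) 1 (snd y)) \<partial>lborel) * ennreal (real CARD('p) * (\<tau>\<^sup>2 / (1 + \<tau>\<^sup>2)))"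
    using nn_integral_lborel_pair_mult[of "\<lambda>x. ennreal (gauss (0::real^'p) \<rho> x)" "\<lambda>z. ennreal (gauss (0::real^'n) 1 z)"]
    by (simp add: nn_integral_gauss \<rho>)
  also have "\<dots> = (\<integral>\<^sup>+y. ennreal (gauss (0::real^'p) \<rho> (fst y)) * ennreal (gauss (0::real^'n) 1 (snd y)) * ennreal (real CARD('p) * (\<tau>\<^sup>2 / (1 + \<tau>\<^sup>2))) \<partial>lborel)"
    by (rule nn_integral_multc[symmetric]) measurable
  also have "\<dots> \<le> (\<integral>\<^sup>+y. (\<integral>\<^sup>+\<theta>. ?L \<theta> y \<partial>lborel) \<partial>lborel)"
    by (intro nn_integral_mono post)
  also have "\<dots> = (\<integral>\<^sup>+\<theta>. (\<integral>\<^sup>+y. ?L \<theta> y \<partial>lborel) \<partial>lborel)"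
    by (rule lborel_pair.Fubini'[OF meas])
  also have "\<dots> = (\<integral>\<^sup>+\<theta>. ennreal (gauss 0 \<tau> \<theta>) * risk d \<theta> 1 \<partial>lborel)"
    by (intro nn_integral_cong) (simp add: risk_eq nn_integral_cmult)
  also have "\<dots> \<le> (\<integral>\<^sup>+\<theta>. ennreal (gauss (0::real^'p) \<tau> \<theta>) * max_risk d \<partial>lborel)"
  proof (intro nn_integral_mono mult_left_mono)
    fix \<theta> :: "real^'p"
    show "risk d \<theta> 1 \<le> max_risk d"
      unfolding max_risk_def by (rule SUP_upper2[of \<theta>]) (auto intro: SUP_upper)
  qed simp
  also have "\<dots> = max_risk d" by (simp add: nn_integral_multc nn_integral_gauss[OF \<tau>])
  finally show ?thesis .
qed

lemma max_risk_ge_dimension: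
  fixes d :: "(real^'p) \<times> (real^'n) \<Rightarrow> real^'p"
  assumes "d \<in> borel_measurable borel"
  shows "ennreal (real CARD('p)) \<le> max_risk d"
proof (cases "max_risk d")
  case (real r)
  define p where "p = real CARD('p)"
  have "p \<le> r"
  proof (rule ccontr)
    assume "\<not> p \<le> r"
    then have pr: "p - r > 0" by simp
    \<comment> \<open>With prior variance \<open>T\<close> the Bayes bound would give
      \<open>(p - r) * T \<le> r\<close>, whereas this product is r + 1.\<close>
    define T where "T = (r + 1) / (p - r)"
    have T: "T > 0" using pr real by (simp add: T_def)
    have "ennreal (p * (T / (1 + T))) \<le> ennreal r"
      using bayes_risk_le_max_risk[OF assms, of "sqrt T"] T real by (simp add: p_def)
    then have "p * (T / (1 + T)) \<le> r" using real by (simp add: ennreal_le_iff)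
    then have "p * T \<le> r * (1 + T)" using T by (simp add: field_simps)
    then have "(p - r) * T \<le> r" by (simp add: algebra_simps)
    then show False using pr by (simp add: T_def)
  qed
  then show ?thesis using real by (simp add: p_def ennreal_leI)
qed simp

section \<open>Minimaxity of the generalized Bayes estimator\<close>

lemma (in beta_ratio) minimax_delta:
  assumes A_eq: "A = real CARD('p)/2 + a + 1" and m_eq: "m = real CARD('n)/2 + e - a"
    and ineq: "\<And>w. w > 0 \<Longrightarrow>
      (real CARD('n) + 2) * (2 * (real CARD('p) - 2) / (real CARD('n) + 2) - \<phi> w) * \<phi> w + 4 * (1 + \<phi> w) * (w * \<phi>' w) \<ge> 0"
  shows "minimax (delta a b e :: (real^'p) \<times> (real^'n) \<Rightarrow> real^'p)"
proof -
  let ?d = "delta a b e :: (real^'p) \<times> (real^'n) \<Rightarrow> real^'p"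
  let ?W = "\<lambda>y::(real^'p) \<times> (real^'n). (norm (fst y))\<^sup>2 / (norm (snd y))\<^sup>2"
  note phi = phi_eq[OF A_eq m_eq]
  define F where "F = (\<lambda>w. if w > 0 then \<phi> w else 0)"
  have [measurable]: "F \<in> borel_measurable borel" unfolding F_def by (rule measurable_\<phi>)
  have "?d = (\<lambda>y. (1 - F (?W y) / ?W y) *\<^sub>R fst y)"
  proof
    fix y :: "(real^'p) \<times> (real^'n)"
    have "?W y \<ge> 0" by simp
    \<comment> \<open>If x or z vanishes, division by zero makes the ratio 0 and the estimator x
      itself, matching \<open>F 0 = 0\<close>.\<close>
    have "phi p n a b e 0 = 0" for p n by (simp add: phi_def)
    with \<open>?W y \<ge> 0\<close> show "?d y = (1 - F (?W y) / ?W y) *\<^sub>R fst y"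
      by (cases "?W y = 0") (simp_all add: delta_def Let_def F_def phi less_le del: divide_eq_0_iff)
  qed
  then have meas: "?d \<in> borel_measurable borel" by simp
  obtain B where B: "\<And>w. w > 0 \<Longrightarrow> \<phi> w \<le> B" "\<And>w. w > 0 \<Longrightarrow> \<bar>\<phi>' w\<bar> \<le> B"
    using \<phi>'_bounded by blast
  have "risk ?d \<theta> \<sigma> \<le> ennreal (real CARD('p))" if "\<sigma> > 0" for \<theta> \<sigma>
  proof (rule risk_le_of_differential_inequality[OF that meas _ \<phi>_deriv \<phi>_pos \<phi>_less B measurable_\<phi>(2)])
    fix x :: "real^'p" and z :: "real^'n" assume "x \<noteq> 0" "z \<noteq> 0"
    then show "?d (x, z) = (1 - \<phi> ((norm x)\<^sup>2 / (norm z)\<^sup>2) / ((norm x)\<^sup>2 / (norm z)\<^sup>2)) *\<^sub>R x"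
      by (simp add: delta_def Let_def phi)
  next
    fix w :: real assume "w > 0"
    define c where "c = 2 * (real CARD('p) - 2) / (real CARD('n) + 2)"
    have c: "(real CARD('n) + 2) * c = 2 * (real CARD('p) - 2)" by (simp add: c_def)
    have "(real CARD('n) + 2) * (c - \<phi> w) * \<phi> w = (real CARD('n) + 2) * c * \<phi> w - (real CARD('n) + 2) * (\<phi> w)\<^sup>2"
      by (simp add: algebra_simps power2_eq_square)
    then show "2 * (real CARD('p) - 2) * \<phi> w - (real CARD('n) + 2) * (\<phi> w)\<^sup>2 + 4 * (1 + \<phi> w) * (w * \<phi>' w) \<ge> 0"
      using ineq[OF \<open>w > 0\<close>, folded c_def] unfolding c by simp
  qed
  then have "max_risk ?d \<le> ennreal (real CARD('p))"
    unfolding max_risk_def by (intro SUP_least) auto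
  then show ?thesis
    unfolding minimax_def using meas
    by (auto intro!: INF_greatest intro: order_trans max_risk_ge_dimension)
qed

theorem theorem3p7:
  fixes a b e :: real
  defines "p \<equiv> real CARD('p)" and "n \<equiv> real CARD('n)"
  defines "c \<equiv> 2 * (p - 2) / (n + 2)"
  defines "\<alpha> \<equiv> (p/2 + a + 1) / (n/2 + e - a)"
  assumes "CARD('p) \<ge> 3"
    and "e > - p/2 - n/2 - 1"
  shows "(- p/2 - 1 < a \<and> a \<le> (c * (n/2 + e) - p/2 - 1) / (1 + c) \<and> b \<ge> min (n/2 + e - a - 1) 0
            \<longrightarrow> minimax (delta a b e :: (real^'p) \<times> (real^'n) \<Rightarrow> real^'p))
       \<and> (- p/2 - 1 < a \<and> a < (c * (n/2 + e) - p/2 - 1) / (1 + c) \<and>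
            -1 < - (n + 2) * (c - \<alpha>) / (4 * (p + a + 1) * (\<alpha> + 1)) \<and>
            - (n + 2) * (c - \<alpha>) / (4 * (p + a + 1) * (\<alpha> + 1)) \<le> b \<and>
            b < min 0 (n/2 + e - a - 1)
            \<longrightarrow> minimax (delta a b e :: (real^'p) \<times> (real^'n) \<Rightarrow> real^'p))"
proof -
  define A m where "A = p/2 + a + 1" and "m = n/2 + e - a"
  have p3: "p \<ge> 3" using assms(5) by (simp add: p_def)
  have n0: "n > 0" by (simp add: n_def)
  have c0: "c > 0" using p3 n0 by (simp add: c_def)
  have nc: "(n + 2) * c = 4 * ((p - 2) / 2)" using n0 by (simp add: c_def)
  \<comment> \<open>The upper bound on \<open>a\<close> is \<alpha> <= c cleared of
    denominators.\<close>
  have Acm: "A \<le> c * m" if "a \<le> (c * (n/2 + e) - p/2 - 1) / (1 + c)"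
  proof -
    have "a * (1 + c) \<le> c * (n/2 + e) - p/2 - 1" using that c0 by (simp add: pos_le_divide_eq)
    then show ?thesis by (simp add: A_def m_def algebra_simps)
  qed
  \<comment> \<open>The sign of the denominator of \<open>\<alpha>\<close> is not assumed; it
    follows from 0 < A <= c m.\<close>
  have m_pos: "m > 0" if "A > 0" "a \<le> (c * (n/2 + e) - p/2 - 1) / (1 + c)"
  proof -
    have "0 < c * m" using Acm that by simp
    then show ?thesis using c0 by (simp add: zero_less_mult_iff)
  qed
  show ?thesis
  proof (intro conjI impI)
    assume H: "- p/2 - 1 < a \<and> a \<le> (c * (n/2 + e) - p/2 - 1) / (1 + c) \<and> b \<ge> min (n/2 + e - a - 1) 0"
    have A0: "A > 0" using H by (simp add: A_def)
    have m0: "m > 0" using m_pos A0 H by blast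
    \<comment> \<open>\<open>b > -1\<close> follows from \<open>m > 0\<close>, because then
      \<open>min (m - 1) 0 > -1\<close>.\<close>
    interpret beta_ratio A b m
      using A0 m0 H by unfold_locales (auto simp: m_def min_def split: if_splits)
    show "minimax (delta a b e :: (real^'p) \<times> (real^'n) \<Rightarrow> real^'p)"
    proof (rule minimax_delta)
      fix w :: real assume "w > 0"
      then show "(real CARD('n) + 2) * (2 * (real CARD('p) - 2) / (real CARD('n) + 2) - \<phi> w) * \<phi> w
          + 4 * (1 + \<phi> w) * (w * \<phi>' w) \<ge> 0"
        unfolding p_def[symmetric] n_def[symmetric] c_def[symmetric]
        by (rule risk_inequality_monotone) (use H Acm n0 in \<open>auto simp: m_def\<close>)
    qed (simp_all add: A_def m_def p_def n_def)
  next
    assume H: "- p/2 - 1 < a \<and> a < (c * (n/2 + e) - p/2 - 1) / (1 + c) \<and>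
            -1 < - (n + 2) * (c - \<alpha>) / (4 * (p + a + 1) * (\<alpha> + 1)) \<and>
            - (n + 2) * (c - \<alpha>) / (4 * (p + a + 1) * (\<alpha> + 1)) \<le> b \<and>
            b < min 0 (n/2 + e - a - 1)"
    have A0: "A > 0" using H by (simp add: A_def)
    have m0: "m > 0" using m_pos A0 H by simp
    have b1: "b > -1" using H by linarith
    interpret beta_ratio A b m using A0 m0 b1 by unfold_locales
    define h where "h = (p - 2) / 2"
    have al: "\<alpha> = A / m" "\<alpha> > 0" using A0 m0 by (auto simp: \<alpha>_def A_def m_def)
    have ph: "p + a + 1 = A + 1 + h" by (simp add: A_def h_def field_simps)
    have h0: "h > 0" using p3 by (simp add: h_def)
    have "- (n + 2) * (c - \<alpha>) \<le> b * (4 * (p + a + 1) * (\<alpha> + 1))"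
      using H A0 h0 al(2) unfolding ph by (subst (asm) pos_divide_le_eq) auto
    then have bnd: "4 * h - (n + 2) * (A / m) \<ge> - 4 * b * (A + 1 + h) * (1 + A / m)"
      using nc unfolding ph al(1) h_def[symmetric] by (simp add: algebra_simps)
    show "minimax (delta a b e :: (real^'p) \<times> (real^'n) \<Rightarrow> real^'p)"
    proof (rule minimax_delta)
      fix w :: real assume "w > 0"
      then show "(real CARD('n) + 2) * (2 * (real CARD('p) - 2) / (real CARD('n) + 2) - \<phi> w) * \<phi> w
          + 4 * (1 + \<phi> w) * (w * \<phi>' w) \<ge> 0"
        unfolding p_def[symmetric] n_def[symmetric] c_def[symmetric]
        by (rule risk_inequality_negative[OF _ _ _ _ bnd])
          (use H n0 nc h0 in \<open>auto simp: m_def h_def\<close>)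
    qed (simp_all add: A_def m_def p_def n_def)
  qed
qed

end
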